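(* Let $m \geq 2$, let $\mu \in \mathbb{R}\setminus\{0\}$, and let $D \subset \mathbb{R}^m$ be a bounded domain such that for every continuous function $f$ on $\partial D$ there exists $v \in C^2(D)\cap C^0(\overline D)$ with $\nabla^2 v - \mu^2 v = 0$ in $D$ and $v = f$ on $\partial D$. Let $u \in C^0(\overline D)$ be real-valued and suppose that for each $x \in D$ there exists a radius $r(x) > 0$ such that $B_{r(x)}(x) \subset D$ and \[ M^\circ(u,x,r(x)) = a^\circ(\mu\, r(x))\, u(x). \] Then $u$ is $\mu$-panharmonic in $D$.
   Context: A domain is a connected open set. A real-valued function $u$ is called $\mu$-panharmonic in $D$ if $u \in C^2(D)$ and $\nabla^2 u - \mu^2 u = 0$ in $D$. $B_r(x)$ is the open ball of radius $r$ centred at $x$, $S_r(x)=\partial B_r(x)$, and $M^\circ(u,x,r) = |S_r|^{-1}\int_{S_r(x)} u(y)\,dS_y$ is the spherical mean, where $|S_r|$ is the area of the sphere of radius $r$. The function $a^\circ$ is $a^\circ(t) = \Gamma(m/2)\, I_{(m-2)/2}(t)/(t/2)^{(m-2)/2}$, where $I_\nu$ is the modified Bessel function of the first kind of order $\nu$; it is understood as the even entire function given by its power series, with $a^\circ(0)=1$. *)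

theory Defs
  imports "HOL-Analysis.Analysis"
begin

definition partial_deriv :: "'a::euclidean_space \<Rightarrow> ('a \<Rightarrow> real) \<Rightarrow> 'a \<Rightarrow> real" where
  "partial_deriv b u x = deriv (\<lambda>t. u (x + t *\<^sub>R b)) 0"

definition C1_on :: "'a::euclidean_space set \<Rightarrow> ('a \<Rightarrow> real) \<Rightarrow> bool" where
  "C1_on D u \<longleftrightarrow> continuous_on D u \<and>
     (\<forall>b\<in>Basis. (\<forall>x\<in>D. (\<lambda>t. u (x + t *\<^sub>R b)) field_differentiable (at 0)) \<and>
                continuous_on D (partial_deriv b u))"

definition C2_on :: "'a::euclidean_space set \<Rightarrow> ('a \<Rightarrow> real) \<Rightarrow> bool" where
  "C2_on D u \<longleftrightarrow> C1_on D u \<and> (\<forall>b\<in>Basis. C1_on D (partial_deriv b u))"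

definition laplacian :: "('a::euclidean_space \<Rightarrow> real) \<Rightarrow> 'a \<Rightarrow> real" where
  "laplacian u x = (\<Sum>b\<in>Basis. partial_deriv b (partial_deriv b u) x)"

definition panharmonic_on :: "real \<Rightarrow> 'a::euclidean_space set \<Rightarrow> ('a \<Rightarrow> real) \<Rightarrow> bool" where
  "panharmonic_on \<mu> D u \<longleftrightarrow> C2_on D u \<and> (\<forall>x\<in>D. laplacian u x - \<mu>\<^sup>2 * u x = 0)"

text \<open>
  Surface measure on the sphere of centre \<open>x\<close> and radius \<open>r > 0\<close>. As usual for spheres, the area of
  a Borel set \<open>A\<close> is \<open>m / r\<close> times the volume of the cone over \<open>A\<close> with apex \<open>x\<close>, \<open>m\<close> being the
  dimension of the space. This cone is the preimage of \<open>A\<close> in the punctured ball under the radial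
  projection, so the measure is obtained as a push-forward of Lebesgue measure; see
  \<open>emeasure_sphere_measure\<close> and \<open>measure_sphere_measure_sphere\<close> below.
\<close>

definition sphere_measure :: "'a::euclidean_space \<Rightarrow> real \<Rightarrow> 'a measure" where
  "sphere_measure x r =
     scale_measure (ennreal (real DIM('a) / r))
       (distr (restrict_space lborel (ball x r - {x})) (restrict_space borel (sphere x r))
          (\<lambda>y. x + (r / norm (y - x)) *\<^sub>R (y - x)))"

definition sphere_mean :: "('a::euclidean_space \<Rightarrow> real) \<Rightarrow> 'a \<Rightarrow> real \<Rightarrow> real" where
  "sphere_mean u x r =
     (\<integral>y. u y \<partial>sphere_measure x r) / measure (sphere_measure x r) (sphere x r)"

text \<open>The modified Bessel function of the first kind, for arguments \<open>t > 0\<close>.\<close>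

definition bessel_I :: "real \<Rightarrow> real \<Rightarrow> real" where
  "bessel_I \<nu> t = (\<Sum>k. (t / 2) powr (2 * real k + \<nu>) / (fact k * Gamma (real k + \<nu> + 1)))"

text \<open>
  The power series of \<open>\<Gamma>(m/2) I\<^bsub>(m-2)/2\<^esub>(t) / (t/2)\<^bsup>(m-2)/2\<^esup>\<close>, which makes sense for every real \<open>t\<close>;
  see \<open>a_circ_eq_bessel_I\<close> below for the agreement with the quotient when \<open>t > 0\<close>.
\<close>

definition a_circ :: "nat \<Rightarrow> real \<Rightarrow> real" where
  "a_circ m t = Gamma (real m / 2) * (\<Sum>k. (t / 2) ^ (2 * k) / (fact k * Gamma (real k + real m / 2)))"

lemma summable_a_circ:
  assumes "m \<ge> 2"
  shows "summable (\<lambda>k. (t / 2) ^ (2 * k) / (fact k * Gamma (real k + real m / 2)))"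
proof (rule summable_comparison_test')
  have G: "Gamma (real m / 2) > 0"
    using assms by (intro Gamma_real_pos) auto
  show "summable (\<lambda>k. ((t / 2)\<^sup>2) ^ k / fact k / Gamma (real m / 2))"
    using summable_exp[of "(t / 2)\<^sup>2"] by (intro summable_divide) (simp add: field_simps)
  fix k :: nat
  have "pochhammer (real m / 2) k \<ge> 1"
    using assms by (auto simp: pochhammer_prod intro!: prod_ge_1)
  moreover have "pochhammer (real m / 2) k = Gamma (real k + real m / 2) / Gamma (real m / 2)"
    using assms by (subst pochhammer_Gamma) (auto simp: add.commute elim!: nonpos_Ints_cases)
  ultimately have "Gamma (real m / 2) \<le> Gamma (real k + real m / 2)"
    using G by (simp add: field_simps)
  then show "norm ((t / 2) ^ (2 * k) / (fact k * Gamma (real k + real m / 2)))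
      \<le> ((t / 2)\<^sup>2) ^ k / fact k / Gamma (real m / 2)"
    using G by (simp add: power_mult abs_mult flip: power_divide) (intro divide_left_mono mult_left_mono mult_pos_pos; simp)
qed

lemma a_circ_eq_bessel_I:
  assumes "m \<ge> 2" "t > 0"
  shows "a_circ m t =
    Gamma (real m / 2) * bessel_I ((real m - 2) / 2) t / (t / 2) powr ((real m - 2) / 2)"
proof -
  have "bessel_I ((real m - 2) / 2) t =
     (\<Sum>k. (t / 2) powr ((real m - 2) / 2) * ((t / 2) ^ (2 * k) / (fact k * Gamma (real k + real m / 2))))"
    unfolding bessel_I_def
  proof (rule suminf_cong)
    fix k
    have 1: "real k + (real m - 2) / 2 + 1 = real k + real m / 2"
      by (simp add: field_simps)
    have "(t / 2) powr (2 * real k) = (t / 2) ^ (2 * k)"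
      using assms powr_realpow[of "t / 2" "2 * k"] by simp
    then show "(t / 2) powr (2 * real k + (real m - 2) / 2) / (fact k * Gamma (real k + (real m - 2) / 2 + 1)) =
      (t / 2) powr ((real m - 2) / 2) * ((t / 2) ^ (2 * k) / (fact k * Gamma (real k + real m / 2)))"
      unfolding 1 powr_add by simp
  qed
  also have "\<dots> = (t / 2) powr ((real m - 2) / 2) *
      (\<Sum>k. (t / 2) ^ (2 * k) / (fact k * Gamma (real k + real m / 2)))"
    by (intro suminf_mult summable_a_circ assms)
  finally show ?thesis
    using assms by (simp add: a_circ_def)
qed

lemma a_circ_0: "m \<ge> 2 \<Longrightarrow> a_circ m 0 = 1"
proof -
  assume m: "m \<ge> 2"
  have "(\<Sum>k. (0 / 2 :: real) ^ (2 * k) / (fact k * Gamma (real k + real m / 2))) =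
        (\<Sum>k\<in>{0}. (0 / 2 :: real) ^ (2 * k) / (fact k * Gamma (real k + real m / 2)))"
    by (intro suminf_finite) auto
  moreover have "Gamma (real m / 2) > 0"
    using m by (intro Gamma_real_pos) auto
  ultimately show ?thesis
    by (simp add: a_circ_def)
qed

lemma radial_projection_measurable:
  assumes "r > 0"
  shows "(\<lambda>y::'a::euclidean_space. x + (r / norm (y - x)) *\<^sub>R (y - x))
    \<in> restrict_space lborel (ball x r - {x}) \<rightarrow>\<^sub>M restrict_space borel (sphere x r)"
proof (rule measurable_restrict_space2)
  show "(\<lambda>y. x + (r / norm (y - x)) *\<^sub>R (y - x))
      \<in> space (restrict_space lborel (ball x r - {x})) \<rightarrow> sphere x r"
    using assms by (auto simp: space_restrict_space dist_norm)
qed (intro measurable_restrict_space1, measurable)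

lemma emeasure_sphere_measure:
  fixes x :: "'a::euclidean_space"
  assumes r: "r > 0" and A: "A \<in> sets borel" "A \<subseteq> sphere x r"
  shows "emeasure (sphere_measure x r) A =
    ennreal (real DIM('a) / r) * emeasure lborel {x + t *\<^sub>R (y - x) |t y. 0 < t \<and> t < 1 \<and> y \<in> A}"
proof -
  let ?f = "\<lambda>y. x + (r / norm (y - x)) *\<^sub>R (y - x)"
  have eq: "?f -` A \<inter> (ball x r - {x}) = {x + t *\<^sub>R (y - x) |t y. 0 < t \<and> t < 1 \<and> y \<in> A}" (is "?L = ?R")
  proof
    show "?L \<subseteq> ?R"
    proof
      fix z assume z: "z \<in> ?L"
      then have "z = x + (norm (z - x) / r) *\<^sub>R (?f z - x)" "0 < norm (z - x) / r" "norm (z - x) / r < 1"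
        using r by (auto simp: dist_norm norm_minus_commute)
      then show "z \<in> ?R" using z by blast
    qed
    show "?R \<subseteq> ?L"
    proof
      fix z assume "z \<in> ?R"
      then obtain t y where z: "z = x + t *\<^sub>R (y - x)" "0 < t" "t < 1" "y \<in> A" by auto
      then have n: "norm (y - x) = r" using A by (auto simp: dist_norm norm_minus_commute)
      then have "?f z = y" "z \<noteq> x" "dist x z < r" using z r by (auto simp: dist_norm)
      then show "z \<in> ?L" using z by auto
    qed
  qed
  have "A \<in> sets (restrict_space borel (sphere x r))"
    using A by (auto simp: sets_restrict_space_iff)
  then show ?thesis
    unfolding sphere_measure_def emeasure_scale_measure
    by (subst emeasure_distr[OF radial_projection_measurable[OF r]])
       (auto simp: space_restrict_space eq intro!: arg_cong2[where f = "(*)"] emeasure_restrict_space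
         simp flip: eq)
qed

lemma measure_sphere_measure_sphere:
  fixes x :: "'a::euclidean_space"
  assumes r: "r > 0"
  shows "measure (sphere_measure x r) (sphere x r) =
    real DIM('a) * unit_ball_vol (real DIM('a)) * r ^ (DIM('a) - 1)"
proof -
  let ?f = "\<lambda>y. x + (r / norm (y - x)) *\<^sub>R (y - x)"
  let ?M = "restrict_space lborel (ball x r - {x})"
  have "?f -` sphere x r \<inter> space ?M = ball x r - {x}"
    using r by (auto simp: space_restrict_space dist_norm)
  then have "emeasure (sphere_measure x r) (sphere x r) =
      ennreal (real DIM('a) / r) * emeasure lborel (ball x r - {x})"
    unfolding sphere_measure_def emeasure_scale_measure
    by (subst emeasure_distr[OF radial_projection_measurable[OF r]])
       (auto simp: sets_restrict_space_iff emeasure_restrict_space)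
  also have "emeasure lborel (ball x r - {x}) = emeasure lborel (ball x r)"
    by (intro emeasure_Diff_null_set) (auto simp: null_sets_def)
  also have "\<dots> = ennreal (unit_ball_vol (real DIM('a)) * r ^ DIM('a))"
    using r by (intro emeasure_ball) auto
  finally have "measure (sphere_measure x r) (sphere x r) =
      real DIM('a) / r * (unit_ball_vol (real DIM('a)) * r ^ DIM('a))"
    using r by (simp add: measure_def flip: ennreal_mult)
  moreover have "r ^ DIM('a) = r * r ^ (DIM('a) - 1)"
    by (simp flip: power_Suc)
  ultimately show ?thesis
    using r by simp
qed

end

theory Submission imports Defs begin

text \<open>
  Let \<open>v\<close> be the solution of the Dirichlet problem with boundary values \<open>u\<close>. If \<open>v\<close> has the mean
  value property \<open>M(v,x,r) = a(\<mu> r) v(x)\<close> on \<^emph>\<open>every\<close> ball in \<open>D\<close>, then the difference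
  \<open>w = u - v\<close> inherits the restricted property of \<open>u\<close>: at each \<open>x\<close> one mean of \<open>w\<close> equals \<open>a(\<mu> r) w(x)\<close>.
  Since \<open>a(\<mu> r) > 1\<close>, a positive maximum of \<open>w\<close> cannot lie in \<open>D\<close>: there a mean would exceed the
  maximum (\<open>restricted_mean_value_max_principle\<close>). As \<open>w\<close> vanishes on the boundary and \<open>-w\<close> behaves
  in the same way, \<open>u = v\<close> in \<open>D\<close>.

  The work lies in the mean value property of panharmonic functions (\<open>panharmonic_sphere_mean\<close>). With
  the centre at the origin, \<open>A(y) = a(\<mu> |y|)\<close> is itself a positive panharmonic function, and \<open>A(0) = 1\<close>,
  so the claim is that the quotient \<open>w = v / A\<close> has the ordinary mean value property. This quotient
  satisfies the divergence equation \<open>div (A\<^sup>2 \<nabla>w) = 0\<close>. Let \<open>k\<close> be a radial function with compact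
  support, and let \<open>q\<close> be the radial function with compact support and \<open>A\<^sup>2 \<nabla>q = k y\<close>; it is found by one
  integration in the radial variable. Then
  \<open>div (q A\<^sup>2 \<nabla>w - w k y) = - w div (k y)\<close>,
  so that \<open>\<integral> w div (k y) = 0\<close>. Between the spheres of radii \<open>\<epsilon> < r\<close> the field \<open>|y|\<^sup>-\<^sup>m y\<close> is free of
  divergence; truncating it suitably gives a Lipschitz weight \<open>k\<close> for which \<open>div (k y)\<close> is the difference of the
  indicators of the balls of radii \<open>r\<close> and \<open>\<epsilon>\<close>, divided by \<open>r\<^sup>m\<close> and \<open>\<epsilon>\<^sup>m\<close>. Hence the mean of \<open>w\<close> over a
  centred ball does not depend on the radius (\<open>panharmonic_quotient_ball_mean\<close>), and by continuity it is
  \<open>w(0)\<close>.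

  The only divergence theorem needed is that a compactly supported field has total divergence zero. It
  follows from the translation invariance of Lebesgue measure and dominated convergence, and it tolerates
  the kinks of \<open>k\<close> on two spheres. Ball means turn into sphere means by a thin shell argument: near
  the boundary sphere \<open>w\<close> is uniformly close to its value at the radial projection, and the integral of a function
  of the radial projection over a shell is proportional to the sphere mean, by scaling. As only uniform
  continuity on the closed ball enters, balls that touch the boundary of \<open>D\<close> are covered.
\<close>

section \<open>Lebesgue integrals and the spherical mean\<close>

lemma integral_lborel_affine:
  fixes f :: "'a::euclidean_space \<Rightarrow> real"
  assumes [measurable]: "f \<in> borel_measurable borel" and "c \<noteq> 0"
  shows "(\<integral>y. f y \<partial>lborel) = \<bar>c\<bar> ^ DIM('a) * (\<integral>y. f (t + c *\<^sub>R y) \<partial>lborel)"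
  by (subst lborel_affine[OF assms(2), of t]) (simp add: integral_density integral_distr)

lemma integral_lborel_translation:
  fixes f :: "'a::euclidean_space \<Rightarrow> real"
  assumes "f \<in> borel_measurable borel"
  shows "(\<integral>y. f (y + t) \<partial>lborel) = (\<integral>y. f y \<partial>lborel)"
  using integral_lborel_affine[OF assms, of 1 t] by (simp add: add.commute)

lemma integrable_lborel_translation:
  fixes f :: "'a::euclidean_space \<Rightarrow> real"
  assumes "integrable lborel f"
  shows "integrable lborel (\<lambda>y. f (y + t))"
proof -
  have "integrable (distr lborel borel ((+) t)) f"
    using assms by (simp add: lborel_distr_plus)
  then show ?thesis
    using assms by (simp add: integrable_distr_eq add.commute)
qed

lemma integral_scale_measure:
  fixes f :: "'a \<Rightarrow> real"
  assumes "c \<ge> 0" "f \<in> borel_measurable M"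
  shows "integral\<^sup>L (scale_measure (ennreal c) M) f = c * integral\<^sup>L M f"
proof -
  have "scale_measure (ennreal c) M = density M (\<lambda>_. ennreal c)"
    by (rule measure_eqI) (auto simp: emeasure_density_const)
  then show ?thesis
    using assms by (simp add: integral_density)
qed

text \<open>
  The surface measure is a push-forward of Lebesgue measure on the ball under the radial projection,
  so a spherical mean is the ball mean of the extension that is constant along rays. All later
  statements about spherical means go through this formula. The centre is removed because the
  projection is discontinuous there.
\<close>

lemma sphere_mean_eq:
  fixes u :: "'a::euclidean_space \<Rightarrow> real"
  assumes R: "R > 0" and u: "continuous_on (sphere c R) u"
  shows "sphere_mean u c R =
    (LINT y:ball 0 R - {0}|lborel. u (c + (R / norm y) *\<^sub>R y)) / (unit_ball_vol (real DIM('a)) * R ^ DIM('a))"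
proof -
  let ?f = "\<lambda>y. c + (R / norm (y - c)) *\<^sub>R (y - c)"
  let ?M = "restrict_space lborel (ball c R - {c})"
  have um: "u \<in> borel_measurable (restrict_space borel (sphere c R))"
    by (rule borel_measurable_continuous_on_restrict[OF u])
  have ufm: "(\<lambda>y. u (?f y)) \<in> borel_measurable ?M"
    by (rule measurable_compose[OF radial_projection_measurable[OF R] um])
  have "integral\<^sup>L (sphere_measure c R) u = real DIM('a) / R * (\<integral>y. u (?f y) \<partial>?M)"
    unfolding sphere_measure_def using R um
    by (simp add: integral_scale_measure integral_distr[OF radial_projection_measurable[OF R] um])
  also have "(\<integral>y. u (?f y) \<partial>?M) = (\<integral>y. indicator (ball c R - {c}) y * u (?f y) \<partial>lborel)"
    by (subst integral_restrict_space) auto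
  also have "\<dots> = (\<integral>y. indicator (ball c R - {c}) (y + c) * u (?f (y + c)) \<partial>lborel)"
  proof (rule integral_lborel_translation[symmetric])
    show "(\<lambda>y. indicator (ball c R - {c}) y * u (?f y)) \<in> borel_measurable borel"
      using borel_measurable_restrict_space_iff[of "ball c R - {c}" lborel "\<lambda>y. u (?f y)"] ufm by simp
  qed
  also have "\<dots> = (LINT y:ball 0 R - {0}|lborel. u (c + (R / norm y) *\<^sub>R y))"
    unfolding set_lebesgue_integral_def
    by (rule Bochner_Integration.integral_cong) (auto simp: indicator_def dist_norm)
  moreover have "R ^ DIM('a) = R * R ^ (DIM('a) - 1)"
    by (simp flip: power_Suc)
  ultimately show ?thesis
    using R by (simp add: sphere_mean_def measure_sphere_measure_sphere)
qed

section \<open>Fields of compact support have total divergence zero\<close>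

text \<open>
  The difference quotient of an integrable function has integral zero, by translation invariance.
  The Lipschitz bound and the bounded support dominate the sums of difference quotients, so
  the limit may be taken under the integral. This is why derivatives almost everywhere are enough.
\<close>

lemma integral_divergence_eq_0:
  fixes G :: "'a::euclidean_space \<Rightarrow> 'a \<Rightarrow> real"
  assumes int: "\<And>b. b \<in> Basis \<Longrightarrow> integrable lborel (G b)"
    and supp: "\<And>b y. b \<in> Basis \<Longrightarrow> norm y \<ge> r \<Longrightarrow> G b y = 0"
    and lip: "\<And>b. b \<in> Basis \<Longrightarrow> \<exists>C. \<forall>y t. \<bar>t\<bar> < \<delta> \<longrightarrow> \<bar>G b (y + t *\<^sub>R b) - G b y\<bar> \<le> C * \<bar>t\<bar>"
    and \<delta>: "\<delta> > 0"
    and div: "AE y in lborel. \<exists>g. (\<forall>b\<in>Basis. ((\<lambda>t. G b (y + t *\<^sub>R b)) has_real_derivative g b) (at 0)) \<and>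
                 (\<Sum>b\<in>Basis. g b) = d y"
    and d: "d \<in> borel_measurable borel"
  shows "(\<integral>y. d y \<partial>lborel) = 0"
proof -
  \<comment> \<open>Any null sequence in the open interval from 0 to \<open>\<delta>\<close> serves as the increments.\<close>
  define h where "h n = \<delta> / (real n + 2)" for n
  have h: "h n > 0" "h n < \<delta>" for n
    using \<delta> by (auto simp: h_def field_simps intro!: add_pos_nonneg)
  have h0: "h \<longlonglongrightarrow> 0"
    unfolding h_def by real_asymp
  define s where "s n y = (\<Sum>b\<in>Basis. (G b (y + h n *\<^sub>R b) - G b y) / h n)" for n y
  have s0: "integrable lborel (s n) \<and> integral\<^sup>L lborel (s n) = 0" for n
  proof -
    have *: "integrable lborel (\<lambda>y. (G b (y + h n *\<^sub>R b) - G b y) / h n) \<and>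
      (\<integral>y. (G b (y + h n *\<^sub>R b) - G b y) / h n \<partial>lborel) = 0" if b: "b \<in> Basis" for b
    proof -
      have "integrable lborel (\<lambda>y. G b (y + h n *\<^sub>R b))"
        by (rule integrable_lborel_translation[OF int[OF b]])
      moreover have "(\<integral>y. G b (y + h n *\<^sub>R b) \<partial>lborel) = (\<integral>y. G b y \<partial>lborel)"
        using int[OF b] by (intro integral_lborel_translation) auto
      ultimately show ?thesis
        using int[OF b] by simp
    qed
    have "integral\<^sup>L lborel (s n) = (\<Sum>b\<in>Basis. \<integral>y. (G b (y + h n *\<^sub>R b) - G b y) / h n \<partial>lborel)"
      unfolding s_def by (rule Bochner_Integration.integral_sum) (use * in blast)
    also have "\<dots> = 0"
      by (rule sum.neutral) (use * in blast)
    finally have "integral\<^sup>L lborel (s n) = 0" .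
    moreover have "integrable lborel (s n)"
      unfolding s_def by (intro Bochner_Integration.integrable_sum) (use * in blast)
    ultimately show ?thesis by blast
  qed
  obtain C where C: "\<And>b y t. b \<in> Basis \<Longrightarrow> \<bar>t\<bar> < \<delta> \<Longrightarrow> \<bar>G b (y + t *\<^sub>R b) - G b y\<bar> \<le> C b * \<bar>t\<bar>"
    using lip by metis
  let ?w = "\<lambda>y. (\<Sum>b\<in>Basis. C b) * indicator (cball 0 (r + \<delta>)) y"
  have "(\<lambda>n. integral\<^sup>L lborel (s n)) \<longlonglongrightarrow> integral\<^sup>L lborel d"
  proof (rule integral_dominated_convergence)
    show "d \<in> borel_measurable lborel" using d by simp
    show "s n \<in> borel_measurable lborel" for n using s0[of n] by auto
    show "integrable lborel ?w"
      by (intro integrable_mult_right integrable_real_indicator emeasure_bounded_finite) auto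
    show "AE y in lborel. (\<lambda>n. s n y) \<longlonglongrightarrow> d y"
      using div
    proof eventually_elim
      case (elim y)
      then obtain g where g: "\<And>b. b \<in> Basis \<Longrightarrow> ((\<lambda>t. G b (y + t *\<^sub>R b)) has_real_derivative g b) (at 0)"
        and dy: "(\<Sum>b\<in>Basis. g b) = d y" by blast
      have "(\<lambda>n. s n y) \<longlonglongrightarrow> (\<Sum>b\<in>Basis. g b)"
        unfolding s_def
      proof (rule tendsto_sum)
        fix b :: 'a assume b: "b \<in> Basis"
        have "((\<lambda>t. (G b (y + t *\<^sub>R b) - G b y) / t) \<longlongrightarrow> g b) (at 0)"
          using g[OF b] by (simp add: has_field_derivative_iff)
        moreover have "filterlim h (at 0) sequentially"
          unfolding filterlim_at using h0 h(1) by (simp add: less_imp_neq[symmetric])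
        ultimately show "(\<lambda>n. (G b (y + h n *\<^sub>R b) - G b y) / h n) \<longlonglongrightarrow> g b"
          by (rule filterlim_compose)
      qed
      then show ?case using dy by simp
    qed
    show "AE y in lborel. norm (s n y) \<le> ?w y" for n
    proof (rule AE_I2)
      fix y :: 'a
      show "norm (s n y) \<le> ?w y"
      proof (cases "y \<in> cball 0 (r + \<delta>)")
        case True
        have "norm (s n y) \<le> (\<Sum>b\<in>Basis. C b)"
          unfolding s_def
        proof (rule sum_norm_le)
          fix b :: 'a assume b: "b \<in> Basis"
          show "norm ((G b (y + h n *\<^sub>R b) - G b y) / h n) \<le> C b"
            using C[OF b, of "h n" y] h[of n] by (simp add: pos_divide_le_eq)
        qed
        then show ?thesis using True by simp
      next
        case False
        have "s n y = 0"
          unfolding s_def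
        proof (intro sum.neutral ballI)
          fix b :: 'a assume b: "b \<in> Basis"
          have "norm y - norm (h n *\<^sub>R b) \<le> norm (y + h n *\<^sub>R b)"
            using norm_triangle_ineq2[of y "- (h n *\<^sub>R b)"] by simp
          then have "G b (y + h n *\<^sub>R b) = 0" "G b y = 0"
            using supp[OF b] False h[of n] b \<delta> by auto
          then show "(G b (y + h n *\<^sub>R b) - G b y) / h n = 0" by simp
        qed
        then show ?thesis using False by simp
      qed
    qed
  qed
  then show ?thesis
    by (simp add: s0 LIMSEQ_const_iff)
qed

section \<open>The power series of the normalised Bessel function\<close>

definition a_circ_coeff :: "nat \<Rightarrow> nat \<Rightarrow> real" where
  "a_circ_coeff m k = Gamma (real m / 2) / (fact k * Gamma (real k + real m / 2))"

text \<open>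
  The function \<open>a_circ\<close> in the variable \<open>z = t\<^sup>2 / 4\<close>, in which it is an ordinary power series; with
  \<open>t = \<mu> |y|\<close> it becomes a smooth function of \<open>|y|\<^sup>2\<close>, also at the origin.
\<close>

definition a_circ_series :: "nat \<Rightarrow> real \<Rightarrow> real" where
  "a_circ_series m z = (\<Sum>k. a_circ_coeff m k * z ^ k)"

lemma a_circ_coeff_0: "m \<ge> 2 \<Longrightarrow> a_circ_coeff m 0 = 1"
  using Gamma_real_pos[of "real m / 2"] by (simp add: a_circ_coeff_def order_less_imp_not_eq2)

lemma a_circ_coeff_pos: "m \<ge> 2 \<Longrightarrow> a_circ_coeff m k > 0"
  unfolding a_circ_coeff_def by (intro divide_pos_pos mult_pos_pos Gamma_real_pos) auto

lemma a_circ_coeff_rec: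
  assumes "m \<ge> 2"
  shows "(real k + real m / 2) * (real (Suc k) * a_circ_coeff m (Suc k)) = a_circ_coeff m k"
proof -
  let ?x = "real k + real m / 2"
  have x: "?x > 0" using assms by (intro add_nonneg_pos) auto
  have "Gamma (1 + ?x) = ?x * Gamma ?x"
    using x Gamma_plus1[of ?x] nonpos_Ints_nonpos[of ?x] by (force simp: add.commute)
  moreover have "Gamma ?x > 0" using x by (rule Gamma_real_pos)
  moreover have "real (Suc k) * a_circ_coeff m (Suc k) = Gamma (real m / 2) / (fact k * Gamma (1 + ?x))"
  proof -
    have "real (Suc k) + real m / 2 = 1 + ?x" by simp
    then show ?thesis
      unfolding a_circ_coeff_def by (simp only: fact_Suc of_nat_mult) (simp del: of_nat_Suc)
  qed
  ultimately show ?thesis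
    using x by (simp only: a_circ_coeff_def) simp
qed

text \<open>
  For \<open>z \<ge> 0\<close> this is the known convergence at \<open>t = 2 sqrt z\<close>. A power series that converges at
  \<open>|z| + 1\<close> converges at \<open>z\<close>, which covers negative \<open>z\<close>.
\<close>

lemma summable_a_circ_series:
  assumes "m \<ge> 2"
  shows "summable (\<lambda>k. a_circ_coeff m k * z ^ k)"
proof (rule powser_inside)
  let ?z = "\<bar>z\<bar> + 1"
  have "(2 * sqrt ?z / 2) ^ (2 * k) = ?z ^ k" for k
    by (simp add: power_mult)
  then show "summable (\<lambda>k. a_circ_coeff m k * ?z ^ k)"
    using summable_mult[OF summable_a_circ[OF assms, of "2 * sqrt ?z"], of "Gamma (real m / 2)"]
    by (simp add: a_circ_coeff_def)
qed auto

lemma a_circ_eq_series: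
  assumes "m \<ge> 2"
  shows "a_circ m t = a_circ_series m (t\<^sup>2 / 4)"
proof -
  have "(t / 2) ^ (2 * k) = (t\<^sup>2 / 4) ^ k" for k
    by (simp add: power_mult power_divide)
  then show ?thesis
    unfolding a_circ_def a_circ_series_def
    by (subst suminf_mult[OF summable_a_circ[OF assms], symmetric]) (simp add: a_circ_coeff_def)
qed

text \<open>
  All coefficients are positive, so for \<open>z \<ge> 0\<close> the series dominates its first two terms.
\<close>

lemma a_circ_series_ge:
  assumes "m \<ge> 2" "z \<ge> 0"
  shows "a_circ_series m z \<ge> 1 + a_circ_coeff m 1 * z"
proof -
  have "(\<Sum>k<2. a_circ_coeff m k * z ^ k) \<le> a_circ_series m z"
    unfolding a_circ_series_def
    using assms a_circ_coeff_pos[OF assms(1)]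
    by (intro sum_le_suminf summable_a_circ_series) (auto simp: less_imp_le)
  then show ?thesis
    using assms by (simp add: numeral_2_eq_2 a_circ_coeff_0)
qed

lemma a_circ_series_pos:
  assumes "m \<ge> 2" "z \<ge> 0"
  shows "a_circ_series m z > 0"
proof -
  have "a_circ_coeff m 1 * z \<ge> 0"
    using a_circ_coeff_pos[OF assms(1), of 1] assms(2) by (intro mult_nonneg_nonneg) auto
  then show ?thesis
    using a_circ_series_ge[OF assms] by linarith
qed

lemma a_circ_gt_1:
  assumes "m \<ge> 2" "t \<noteq> 0"
  shows "a_circ m t > 1"
proof -
  have "a_circ_coeff m 1 * (t\<^sup>2 / 4) > 0"
    using a_circ_coeff_pos[OF assms(1), of 1] assms(2) by (intro mult_pos_pos) auto
  then show ?thesis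
    using a_circ_series_ge[of m "t\<^sup>2 / 4"] assms(1) by (simp add: a_circ_eq_series)
qed

text \<open>
  The recursion of the coefficients is Bessel's equation in the variable \<open>z\<close>. For
  \<open>z = \<mu>\<^sup>2 |y|\<^sup>2 / 4\<close> in dimension \<open>m\<close> it says that the function of \<open>y\<close> so obtained is panharmonic.
\<close>

lemma a_circ_series_ode:
  assumes m: "m \<ge> 2"
  obtains B1 B2 where
    "\<And>z. (a_circ_series m has_real_derivative B1 z) (at z)"
    "\<And>z. (B1 has_real_derivative B2 z) (at z)"
    "continuous_on UNIV B2"
    "\<And>z. z * B2 z + real m / 2 * B1 z = a_circ_series m z"
proof -
  let ?c = "a_circ_coeff m"
  define B1 where "B1 z = (\<Sum>k. diffs ?c k * z ^ k)" for z
  define B2 where "B2 z = (\<Sum>k. diffs (diffs ?c) k * z ^ k)" for z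
  note s0 = summable_a_circ_series[OF m]
  have s1: "summable (\<lambda>k. diffs ?c k * z ^ k)" for z
    by (rule termdiff_converges_all) (rule s0)
  have s2: "summable (\<lambda>k. diffs (diffs ?c) k * z ^ k)" for z
    by (rule termdiff_converges_all) (rule s1)
  have d0: "(a_circ_series m has_real_derivative B1 z) (at z)" for z
    unfolding a_circ_series_def[abs_def] B1_def
    by (rule termdiffs_strong_converges_everywhere) (rule s0)
  have d1: "(B1 has_real_derivative B2 z) (at z)" for z
    unfolding B1_def[abs_def] B2_def
    by (rule termdiffs_strong_converges_everywhere) (rule s1)
  have "(B2 has_real_derivative (\<Sum>k. diffs (diffs (diffs ?c)) k * z ^ k)) (at z)" for z
    unfolding B2_def[abs_def]
    by (rule termdiffs_strong_converges_everywhere) (rule s2)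
  then have c2: "continuous_on UNIV B2"
    by (intro DERIV_continuous_on) auto
  have "z * B2 z + real m / 2 * B1 z = a_circ_series m z" for z
  proof -
    have "(\<lambda>n. z * (of_nat n * diffs ?c n * z ^ (n - Suc 0))) sums (z * B2 z)"
      unfolding B2_def by (intro sums_mult diffs_equiv s2)
    moreover have "z * (of_nat n * diffs ?c n * z ^ (n - Suc 0)) = real n * diffs ?c n * z ^ n" for n
      by (cases n) auto
    ultimately have "(\<lambda>n. real n * diffs ?c n * z ^ n) sums (z * B2 z)"
      by simp
    moreover have "(\<lambda>n. real m / 2 * (diffs ?c n * z ^ n)) sums (real m / 2 * B1 z)"
      unfolding B1_def by (intro sums_mult summable_sums s1)
    ultimately have "(\<lambda>n. real n * diffs ?c n * z ^ n + real m / 2 * (diffs ?c n * z ^ n)) sums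
        (z * B2 z + real m / 2 * B1 z)"
      by (rule sums_add)
    also have "(\<lambda>n. real n * diffs ?c n * z ^ n + real m / 2 * (diffs ?c n * z ^ n)) = (\<lambda>n. ?c n * z ^ n)"
      by (subst a_circ_coeff_rec[OF m, symmetric]) (simp add: fun_eq_iff diffs_def algebra_simps)
    finally show ?thesis
      unfolding a_circ_series_def by (simp add: sums_iff)
  qed
  then show ?thesis
    using that d0 d1 c2 by blast
qed

section \<open>Lipschitz continuity in one direction\<close>

text \<open>
  The panharmonic function has only directional derivatives to start from, and the divergence lemma
  moves in one coordinate direction at a time. Lipschitz continuity along lines parallel to \<open>b\<close> is all
  that is required, and it is stable under products of bounded functions.
\<close>

definition dir_lipschitz :: "'a::real_normed_vector \<Rightarrow> 'a set \<Rightarrow> ('a \<Rightarrow> real) \<Rightarrow> bool" where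
  "dir_lipschitz b S f \<longleftrightarrow>
     (\<exists>C. \<forall>y\<in>S. \<forall>t. y + t *\<^sub>R b \<in> S \<longrightarrow> \<bar>f (y + t *\<^sub>R b) - f y\<bar> \<le> C * \<bar>t\<bar>)"

lemma dir_lipschitz_diff:
  assumes "dir_lipschitz b S f" "dir_lipschitz b S g"
  shows "dir_lipschitz b S (\<lambda>y. f y - g y)"
proof -
  obtain C C' where "\<forall>y\<in>S. \<forall>t. y + t *\<^sub>R b \<in> S \<longrightarrow> \<bar>f (y + t *\<^sub>R b) - f y\<bar> \<le> C * \<bar>t\<bar>"
    "\<forall>y\<in>S. \<forall>t. y + t *\<^sub>R b \<in> S \<longrightarrow> \<bar>g (y + t *\<^sub>R b) - g y\<bar> \<le> C' * \<bar>t\<bar>"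
    using assms unfolding dir_lipschitz_def by blast
  then have "\<forall>y\<in>S. \<forall>t. y + t *\<^sub>R b \<in> S \<longrightarrow>
      \<bar>(f (y + t *\<^sub>R b) - g (y + t *\<^sub>R b)) - (f y - g y)\<bar> \<le> (C + C') * \<bar>t\<bar>"
    by (fastforce simp: distrib_right intro: order_trans[OF abs_triangle_ineq4] add_mono
          order_trans[OF _ add_mono])
  then show ?thesis
    unfolding dir_lipschitz_def by blast
qed

lemma dir_lipschitz_mult:
  assumes "dir_lipschitz b S f" "dir_lipschitz b S g" "bounded (f ` S)" "bounded (g ` S)"
  shows "dir_lipschitz b S (\<lambda>y. f y * g y)"
proof -
  obtain C C' where C: "\<forall>y\<in>S. \<forall>t. y + t *\<^sub>R b \<in> S \<longrightarrow> \<bar>f (y + t *\<^sub>R b) - f y\<bar> \<le> C * \<bar>t\<bar>"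
    "\<forall>y\<in>S. \<forall>t. y + t *\<^sub>R b \<in> S \<longrightarrow> \<bar>g (y + t *\<^sub>R b) - g y\<bar> \<le> C' * \<bar>t\<bar>"
    using assms unfolding dir_lipschitz_def by blast
  obtain K K' where K: "\<forall>y\<in>S. \<bar>f y\<bar> \<le> K" "\<forall>y\<in>S. \<bar>g y\<bar> \<le> K'"
    using assms(3,4) unfolding bounded_iff by auto
  have "\<bar>f (y + t *\<^sub>R b) * g (y + t *\<^sub>R b) - f y * g y\<bar> \<le> (K * C' + C * K') * \<bar>t\<bar>"
    if y: "y \<in> S" "y + t *\<^sub>R b \<in> S" for y t
  proof -
    let ?z = "y + t *\<^sub>R b"
    have "\<bar>f ?z * g ?z - f y * g y\<bar> = \<bar>f ?z * (g ?z - g y) + (f ?z - f y) * g y\<bar>"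
      by (simp add: algebra_simps)
    also have "\<dots> \<le> \<bar>f ?z\<bar> * \<bar>g ?z - g y\<bar> + \<bar>f ?z - f y\<bar> * \<bar>g y\<bar>"
      by (metis abs_mult abs_triangle_ineq)
    also have "\<dots> \<le> K * (C' * \<bar>t\<bar>) + (C * \<bar>t\<bar>) * K'"
      using C K y by (intro add_mono mult_mono) (auto intro: order_trans[OF abs_ge_zero])
    finally show ?thesis by (simp add: algebra_simps)
  qed
  then show ?thesis
    unfolding dir_lipschitz_def by blast
qed

lemma dir_lipschitz_if_lipschitz_on:
  assumes "C-lipschitz_on S f"
  shows "dir_lipschitz b S f"
  unfolding dir_lipschitz_def
proof (intro exI ballI allI impI)
  fix y t assume "y \<in> S" "y + t *\<^sub>R b \<in> S"
  then have "dist (f (y + t *\<^sub>R b)) (f y) \<le> C * dist (y + t *\<^sub>R b) y"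
    using assms by (intro lipschitz_onD) auto
  then show "\<bar>f (y + t *\<^sub>R b) - f y\<bar> \<le> (C * norm b) * \<bar>t\<bar>"
    by (simp add: dist_norm mult_ac)
qed

text \<open>
  Along each line this is the one-dimensional mean value inequality; convexity keeps the segment
  inside the set.
\<close>

lemma dir_lipschitz_if_derivative:
  assumes S: "convex S"
    and f: "\<And>y. y \<in> S \<Longrightarrow> ((\<lambda>t. f (y + t *\<^sub>R b)) has_real_derivative f' y) (at 0)"
    and f': "bounded (f' ` S)"
  shows "dir_lipschitz b S f"
proof -
  obtain C where C: "\<And>y. y \<in> S \<Longrightarrow> \<bar>f' y\<bar> \<le> C"
    using f' unfolding bounded_iff by auto
  have "\<bar>f (y + t *\<^sub>R b) - f y\<bar> \<le> C * \<bar>t\<bar>" if y: "y \<in> S" "y + t *\<^sub>R b \<in> S" for y t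
  proof -
    let ?T = "{s. y + s *\<^sub>R b \<in> S}"
    have "convex ((\<lambda>s. s *\<^sub>R b) -` ((\<lambda>z. z - y) ` S))"
      by (intro convex_linear_vimage convex_translation_subtract S) (auto intro!: linearI simp: algebra_simps)
    also have "(\<lambda>s. s *\<^sub>R b) -` ((\<lambda>z. z - y) ` S) = ?T"
      by (auto simp: image_iff algebra_simps intro: bexI[of _ "y + _"])
    finally have T: "convex ?T" .
    have "norm (f (y + t *\<^sub>R b) - f (y + 0 *\<^sub>R b)) \<le> C * norm (t - 0)"
    proof (rule field_differentiable_bound[OF T, where f' = "\<lambda>s. f' (y + s *\<^sub>R b)"])
      fix s assume s: "s \<in> ?T"
      have "((\<lambda>t. f (y + (t + s) *\<^sub>R b)) has_real_derivative f' (y + s *\<^sub>R b)) (at 0)"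
        using f[of "y + s *\<^sub>R b"] s by (simp add: algebra_simps)
      then have "((\<lambda>t. f (y + t *\<^sub>R b)) has_real_derivative f' (y + s *\<^sub>R b)) (at s)"
        using DERIV_shift[of "\<lambda>t. f (y + t *\<^sub>R b)" _ 0 s] by simp
      then show "((\<lambda>t. f (y + t *\<^sub>R b)) has_real_derivative f' (y + s *\<^sub>R b)) (at s within ?T)"
        by (rule DERIV_subset) auto
    qed (use y C in auto)
    then show ?thesis by simp
  qed
  then show ?thesis
    unfolding dir_lipschitz_def by blast
qed

section \<open>Radial functions and the truncated radial weight\<close>

text \<open>
  The coefficient \<open>k\<close> of the radial field \<open>k(|y|) y\<close>. It is constant up to radius \<open>\<epsilon>\<close>, and in between
  it is \<open>-|y|\<^sup>-\<^sup>m / m\<close>, which makes the field divergence-free, plus the constant that makes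
  \<open>k\<close> continuous with value \<open>0\<close> from radius \<open>r\<close> on.
\<close>

definition annular_weight :: "nat \<Rightarrow> real \<Rightarrow> real \<Rightarrow> real \<Rightarrow> real" where
  "annular_weight m \<epsilon> r \<rho> = (1 / r ^ m - 1 / (max \<epsilon> (min \<rho> r)) ^ m) / real m"

lemma annular_weight_eq_0: "0 < \<epsilon> \<Longrightarrow> \<epsilon> < r \<Longrightarrow> r \<le> \<rho> \<Longrightarrow> annular_weight m \<epsilon> r \<rho> = 0"
  by (simp add: annular_weight_def)

lemma continuous_on_annular_weight [continuous_intros]:
  assumes "0 < \<epsilon>" "continuous_on S f"
  shows "continuous_on S (\<lambda>x. annular_weight m \<epsilon> r (f x))"
  unfolding annular_weight_def divide_inverse
  using assms by (intro continuous_intros) (auto simp: less_max_iff_disj)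

text \<open>
  The kinks at radii \<open>\<epsilon>\<close> and \<open>r\<close> come from truncating \<open>|y|\<close> to \<open>[\<epsilon>, r]\<close>, which does not increase
  distances, and on this interval the remaining function of the radius is continuously differentiable.
\<close>

lemma lipschitz_on_annular_weight:
  assumes "0 < \<epsilon>" "\<epsilon> < r"
  obtains C where "C-lipschitz_on UNIV (\<lambda>y::'a::euclidean_space. annular_weight m \<epsilon> r (norm y))"
proof -
  let ?g = "\<lambda>\<rho>. (1 / r ^ m - 1 / \<rho> ^ m) / real m"
  let ?g' = "\<lambda>\<rho>. \<rho> ^ (m - 1) / (\<rho> ^ m)\<^sup>2"
  have "continuous_on {\<epsilon>..r} ?g'"
    using assms by (intro continuous_intros) auto
  then have "bounded (?g' ` {\<epsilon>..r})"
    by (intro compact_imp_bounded compact_continuous_image) auto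
  then obtain C where "\<forall>z\<in>?g' ` {\<epsilon>..r}. norm z \<le> C"
    unfolding bounded_iff by blast
  then have C: "\<bar>?g' \<rho>\<bar> \<le> C" if "\<rho> \<in> {\<epsilon>..r}" for \<rho>
    using that by (simp only: ball_simps real_norm_def)
  have "C \<ge> 0"
    using order_trans[OF abs_ge_zero C[of r]] assms by simp
  have g: "\<bar>?g a - ?g b\<bar> \<le> C * \<bar>a - b\<bar>" if "a \<in> {\<epsilon>..r}" "b \<in> {\<epsilon>..r}" for a b
  proof (cases "m = 0")
    case False
    have "norm (?g a - ?g b) \<le> C * norm (a - b)"
    proof (rule field_differentiable_bound[of "{\<epsilon>..r}" _ ?g'])
      fix \<rho> assume \<rho>: "\<rho> \<in> {\<epsilon>..r}"
      show "(?g has_real_derivative ?g' \<rho>) (at \<rho> within {\<epsilon>..r})"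
        using \<rho> assms False
        by (auto intro!: derivative_eq_intros simp: power2_eq_square)
    qed (use that C in auto)
    then show ?thesis by simp
  qed (use \<open>C \<ge> 0\<close> in auto)
  have "C-lipschitz_on UNIV (\<lambda>y::'a. annular_weight m \<epsilon> r (norm y))"
  proof (rule lipschitz_onI)
    fix x y :: 'a
    let ?c = "\<lambda>y::'a. max \<epsilon> (min (norm y) r)"
    have "\<bar>?g (?c x) - ?g (?c y)\<bar> \<le> C * \<bar>?c x - ?c y\<bar>"
      using assms by (intro g) auto
    also have "\<dots> \<le> C * norm (x - y)"
    proof (intro mult_left_mono)
      have "\<bar>?c x - ?c y\<bar> \<le> \<bar>min (norm x) r - min (norm y) r\<bar>"
        by (auto simp: max_def)
      also have "\<dots> \<le> \<bar>norm x - norm y\<bar>"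
        by (auto simp: min_def)
      also have "\<dots> \<le> norm (x - y)"
        by (rule norm_triangle_ineq3)
      finally show "\<bar>?c x - ?c y\<bar> \<le> norm (x - y)" .
    qed (fact \<open>C \<ge> 0\<close>)
    finally show "dist (annular_weight m \<epsilon> r (norm x)) (annular_weight m \<epsilon> r (norm y)) \<le> C * dist x y"
      by (simp add: annular_weight_def dist_norm)
  qed (fact \<open>C \<ge> 0\<close>)
  then show ?thesis by (rule that)
qed

lemma has_real_derivative_inner_line:
  fixes y b :: "'a::real_inner"
  shows "((\<lambda>t. (y + t *\<^sub>R b) \<bullet> (y + t *\<^sub>R b)) has_real_derivative 2 * (y \<bullet> b)) (at 0)"
proof -
  have "((\<lambda>t. y \<bullet> y + 2 * t * (y \<bullet> b) + t\<^sup>2 * (b \<bullet> b)) has_real_derivative 2 * (y \<bullet> b)) (at 0)"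
    by (auto intro!: derivative_eq_intros)
  also have "(\<lambda>t. y \<bullet> y + 2 * t * (y \<bullet> b) + t\<^sup>2 * (b \<bullet> b)) = (\<lambda>t. (y + t *\<^sub>R b) \<bullet> (y + t *\<^sub>R b))"
    by (simp add: fun_eq_iff inner_add_left inner_add_right inner_commute power2_eq_square)
  finally show ?thesis .
qed

lemma has_real_derivative_radial_line:
  fixes y b :: "'a::real_inner"
  assumes "(f has_real_derivative f') (at (y \<bullet> y))"
  shows "((\<lambda>t. f ((y + t *\<^sub>R b) \<bullet> (y + t *\<^sub>R b))) has_real_derivative f' * (2 * (y \<bullet> b))) (at 0)"
  using DERIV_chain2[OF _ has_real_derivative_inner_line, of f f' y b] assms by simp

definition annular_weight_deriv :: "nat \<Rightarrow> real \<Rightarrow> real \<Rightarrow> 'a::real_inner \<Rightarrow> 'a \<Rightarrow> real" where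
  "annular_weight_deriv m \<epsilon> r b y =
     (if norm y < \<epsilon> then 0 else if norm y < r then (y \<bullet> b) / norm y ^ (m + 2) else 0)"

lemma eventually_norm_line:
  fixes y b :: "'a::real_normed_vector"
  assumes "open T" "norm y \<in> T"
  shows "eventually (\<lambda>t. norm (y + t *\<^sub>R b) \<in> T) (nhds 0)"
proof -
  have "((\<lambda>t. norm (y + t *\<^sub>R b)) \<longlongrightarrow> norm (y + 0 *\<^sub>R b)) (nhds 0)"
    by (intro tendsto_intros) (auto simp: filterlim_ident)
  then show ?thesis
    using assms by (auto dest: topological_tendstoD)
qed

lemma has_real_derivative_annular_weight_line:
  fixes y b :: "'a::euclidean_space"
  assumes "m > 0" "0 < \<epsilon>" "\<epsilon> < r" "norm y \<noteq> \<epsilon>" "norm y \<noteq> r"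
  shows "((\<lambda>t. annular_weight m \<epsilon> r (norm (y + t *\<^sub>R b))) has_real_derivative
      annular_weight_deriv m \<epsilon> r b y) (at 0)"
proof -
  consider "norm y < \<epsilon>" | "\<epsilon> < norm y" "norm y < r" | "norm y > r"
    using assms by linarith
  then show ?thesis
  proof cases
    case 1
    have ev: "eventually (\<lambda>t. annular_weight m \<epsilon> r (norm (y + t *\<^sub>R b)) = (1 / r ^ m - 1 / \<epsilon> ^ m) / real m) (nhds 0)"
      by (rule eventually_mono[OF eventually_norm_line[of "{..<\<epsilon>}" y b]])
         (use 1 assms in \<open>auto simp: annular_weight_def\<close>)
    show ?thesis
      by (subst DERIV_cong_ev[OF refl ev refl]) (use 1 in \<open>simp add: annular_weight_deriv_def\<close>)
  next
    case 2
    have ev: "eventually (\<lambda>t. annular_weight m \<epsilon> r (norm (y + t *\<^sub>R b)) =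
        (1 / r ^ m - 1 / (sqrt ((y + t *\<^sub>R b) \<bullet> (y + t *\<^sub>R b))) ^ m) / real m) (nhds 0)"
      by (rule eventually_mono[OF eventually_norm_line[of "{\<epsilon><..<r}" y b]])
         (use 2 in \<open>auto simp: annular_weight_def norm_eq_sqrt_inner\<close>)
    have n: "sqrt (y \<bullet> y) = norm y" "norm y > 0" "y \<bullet> y > 0" "sqrt (y \<bullet> y) > 0"
      using 2 assms by (auto simp: norm_eq_sqrt_inner)
    have "((\<lambda>s. (1 / r ^ m - 1 / (sqrt s) ^ m) / real m) has_real_derivative
        inverse (2 * norm y ^ (m + 2))) (at (y \<bullet> y))"
    proof -
      have "((\<lambda>s. (1 / r ^ m - 1 / (sqrt s) ^ m) / real m) has_real_derivative
        (real m * (sqrt (y \<bullet> y) ^ (m - 1) * (inverse (sqrt (y \<bullet> y)) / 2))) / (sqrt (y \<bullet> y) ^ m * sqrt (y \<bullet> y) ^ m) / real m) (at (y \<bullet> y))"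
        using n(3,4) assms(1) by (auto intro!: derivative_eq_intros simp: leD[OF inner_ge_zero])
      also have "(real m * (sqrt (y \<bullet> y) ^ (m - 1) * (inverse (sqrt (y \<bullet> y)) / 2))) / (sqrt (y \<bullet> y) ^ m * sqrt (y \<bullet> y) ^ m) / real m
         = inverse (2 * norm y ^ (m + 2))"
        unfolding n(1) using n(2) assms(1) by (cases m) (auto simp: field_simps simp del: of_nat_Suc)
      finally show ?thesis .
    qed
    note d = has_real_derivative_radial_line[OF this, of b]
    have "inverse (2 * p) * (2 * q) = q / p" for p q :: real
      by (simp add: field_simps)
    then have "inverse (2 * norm y ^ (m + 2)) * (2 * (y \<bullet> b)) = annular_weight_deriv m \<epsilon> r b y"
      using 2 by (simp only: annular_weight_deriv_def) simp
    then show ?thesis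
      using d unfolding DERIV_cong_ev[OF refl ev refl] by (simp only:)
  next
    case 3
    have ev: "eventually (\<lambda>t. annular_weight m \<epsilon> r (norm (y + t *\<^sub>R b)) = 0) (nhds 0)"
      by (rule eventually_mono[OF eventually_norm_line[of "{r<..}" y b]])
         (use 3 assms in \<open>auto simp: annular_weight_eq_0\<close>)
    show ?thesis
      by (subst DERIV_cong_ev[OF refl ev refl]) (use 3 assms in \<open>simp add: annular_weight_deriv_def\<close>)
  qed
qed

text \<open>
  Inside radius \<open>\<epsilon>\<close> the divergence is \<open>m\<close> times the constant value of the weight. In the shell the
  radial derivative contributes \<open>|y|\<^sup>-\<^sup>m\<close>, which cancels the variable part of \<open>m\<close> times the weight
  and leaves \<open>r\<^sup>-\<^sup>m\<close>.
\<close>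

lemma divergence_annular_weight:
  fixes y :: "'a::euclidean_space"
  assumes "0 < \<epsilon>" "\<epsilon> < r" "norm y \<noteq> \<epsilon>" "norm y \<noteq> r"
  shows "(\<Sum>b\<in>Basis. annular_weight_deriv DIM('a) \<epsilon> r b y * (y \<bullet> b) + annular_weight DIM('a) \<epsilon> r (norm y))
    = indicator (ball 0 r) y / r ^ DIM('a) - indicator (ball 0 \<epsilon>) y / \<epsilon> ^ DIM('a)"
proof -
  have sq: "(\<Sum>b\<in>Basis. (y \<bullet> b) * (y \<bullet> b)) = (norm y)\<^sup>2"
    by (simp flip: euclidean_inner power2_norm_eq_inner)
  consider "norm y < \<epsilon>" | "\<epsilon> < norm y" "norm y < r" | "norm y > r"
    using assms by linarith
  then show ?thesis
  proof cases
    case 2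
    have "(\<Sum>b\<in>Basis. annular_weight_deriv DIM('a) \<epsilon> r b y * (y \<bullet> b)) =
        (\<Sum>b\<in>Basis. (y \<bullet> b) * (y \<bullet> b)) / norm y ^ (DIM('a) + 2)"
      unfolding sum_divide_distrib by (rule sum.cong) (use 2 in \<open>auto simp: annular_weight_deriv_def\<close>)
    also have "\<dots> = 1 / norm y ^ DIM('a)"
      unfolding sq using 2 assms by (auto simp: field_simps power2_eq_square)
    finally show ?thesis
      using 2 assms by (simp add: sum.distrib annular_weight_def)
  qed (use assms in \<open>auto simp: annular_weight_def annular_weight_deriv_def\<close>)
qed

text \<open>
  The antiderivative normalised to vanish at \<open>T\<close> stays zero beyond \<open>T\<close>. In its use below it yields
  the radial function \<open>q\<close> with prescribed gradient and bounded support.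
\<close>

lemma continuous_antiderivative_vanishing_above:
  fixes h :: "real \<Rightarrow> real"
  assumes h: "continuous_on UNIV h" and h0: "\<And>s. s \<ge> T \<Longrightarrow> h s = 0" and T: "T > 0"
  obtains Q where "\<And>s. s \<ge> 0 \<Longrightarrow> (Q has_real_derivative h s) (at s)" "\<And>s. s \<ge> T \<Longrightarrow> Q s = 0"
proof -
  \<comment> \<open>Starting at \<open>-1\<close> makes \<open>0\<close> an interior point of the interval of integration.\<close>
  define P where "P s = integral {-1..s} h" for s
  have P: "(P has_real_derivative h s) (at s)" if "s \<ge> 0" for s
  proof -
    have "(P has_real_derivative h s) (at s within {-1..s+1})"
      unfolding P_def[abs_def]
      by (rule integral_has_real_derivative) (use that h in \<open>auto intro: continuous_on_subset\<close>)
    moreover have "at s within {-1..s+1} = at s"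
      using that by (intro at_within_interior) simp
    ultimately show ?thesis by simp
  qed
  have PT: "P s = P T" if "s \<ge> T" for s
  proof -
    have "P s = P T + integral {T..s} h"
      unfolding P_def using that T h
      by (intro Henstock_Kurzweil_Integration.integral_combine[symmetric] integrable_continuous_real)
         (auto intro: continuous_on_subset)
    also have "integral {T..s} h = integral {T..s} (\<lambda>_. 0)"
      by (rule Henstock_Kurzweil_Integration.integral_cong) (use h0 in auto)
    finally show ?thesis by simp
  qed
  show ?thesis
  proof (rule that[of "\<lambda>s. P s - P T"])
    show "((\<lambda>s. P s - P T) has_real_derivative h s) (at s)" if "s \<ge> 0" for s
      using P[OF that] by (auto intro!: derivative_eq_intros)
    show "P s - P T = 0" if "s \<ge> T" for s
      using PT[OF that] by simp
  qed
qed

section \<open>Ball means of the quotient of a panharmonic function\<close>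

lemma set_integrable_ball_continuous:
  fixes w :: "'a::euclidean_space \<Rightarrow> real"
  assumes "continuous_on (ball 0 R) w" "r < R"
  shows "set_integrable lborel (ball 0 r) w"
proof (rule set_integrable_subset)
  have "continuous_on (cball 0 r) w"
    using assms by (auto intro: continuous_on_subset)
  then show "set_integrable lborel (cball 0 r) w"
    unfolding set_integrable_def by (intro borel_integrable_compact) auto
qed auto

text \<open>
  This is the divergence lemma for the field \<open>q A\<^sup>2 \<nabla>w - w k y\<close>, where \<open>A(y) = a(\<mu> |y|)\<close>,
  \<open>w = v / A\<close>, \<open>k\<close> is the truncated weight and \<open>q\<close> is the radial solution of \<open>A\<^sup>2 \<nabla>q = k y\<close>. The cross
  terms \<open>A\<^sup>2 \<nabla>w \<bullet> \<nabla>q\<close> and \<open>k y \<bullet> \<nabla>w\<close> cancel, and \<open>div (A\<^sup>2 \<nabla>w) = A \<Delta>v - v \<Delta>A = 0\<close> because \<open>v\<close> and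
  \<open>A\<close> solve the same equation. What remains is \<open>- w div (k y)\<close>, a difference of two normalised ball
  indicators times \<open>w\<close>.
\<close>

lemma panharmonic_quotient_ball_mean:
  fixes v :: "'a::euclidean_space \<Rightarrow> real"
  assumes m: "DIM('a) \<ge> 2" and \<epsilon>: "0 < \<epsilon>" and r: "\<epsilon> < r" "r < R"
    and v: "\<And>b y. b \<in> Basis \<Longrightarrow> norm y < R \<Longrightarrow> ((\<lambda>t. v (y + t *\<^sub>R b)) has_real_derivative dv b y) (at 0)"
    and dv: "\<And>b y. b \<in> Basis \<Longrightarrow> norm y < R \<Longrightarrow> ((\<lambda>t. dv b (y + t *\<^sub>R b)) has_real_derivative ddv b y) (at 0)"
    and cv: "continuous_on (ball 0 R) v"
    and cdv: "\<And>b. b \<in> Basis \<Longrightarrow> continuous_on (ball 0 R) (dv b)"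
    and cddv: "\<And>b. b \<in> Basis \<Longrightarrow> continuous_on (ball 0 R) (ddv b)"
    and pde: "\<And>y. norm y < R \<Longrightarrow> (\<Sum>b\<in>Basis. ddv b y) = \<mu>\<^sup>2 * v y"
  shows "(LINT y:ball 0 r|lborel. v y / a_circ DIM('a) (\<mu> * norm y)) / r ^ DIM('a) =
         (LINT y:ball 0 \<epsilon>|lborel. v y / a_circ DIM('a) (\<mu> * norm y)) / \<epsilon> ^ DIM('a)"
proof -
  let ?m = "DIM('a)"
  let ?c = "\<mu>\<^sup>2 / 4"
  obtain B1 B2 where B: "\<And>z. (a_circ_series ?m has_real_derivative B1 z) (at z)"
    "\<And>z. (B1 has_real_derivative B2 z) (at z)" "continuous_on UNIV B2"
    "\<And>z. z * B2 z + real ?m / 2 * B1 z = a_circ_series ?m z"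
    using a_circ_series_ode[OF m] by blast
  \<comment> \<open>\<open>\<alpha>\<close> expresses \<open>A\<close> as a function of \<open>s = |y|\<^sup>2\<close>, since \<open>(\<mu> |y|)\<^sup>2 / 4 = (\<mu>\<^sup>2 / 4) s\<close>.\<close>
  define \<alpha> where "\<alpha> s = a_circ_series ?m (?c * s)" for s
  define \<alpha>1 where "\<alpha>1 s = B1 (?c * s) * ?c" for s
  define \<alpha>2 where "\<alpha>2 s = B2 (?c * s) * ?c * ?c" for s
  have lin: "((\<lambda>s. ?c * s) has_real_derivative ?c) (at s)" for s
    by (auto intro!: derivative_eq_intros)
  have \<alpha>: "(\<alpha> has_real_derivative \<alpha>1 s) (at s)" for s
    unfolding \<alpha>_def[abs_def] \<alpha>1_def by (rule DERIV_chain2[OF B(1) lin])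
  have \<alpha>1: "(\<alpha>1 has_real_derivative \<alpha>2 s) (at s)" for s
    unfolding \<alpha>1_def[abs_def] \<alpha>2_def by (intro DERIV_cmult_right DERIV_chain2[OF B(2) lin])
  have c\<alpha>: "continuous_on UNIV \<alpha>" "continuous_on UNIV \<alpha>1"
    using \<alpha> \<alpha>1 by (auto intro: DERIV_continuous_on)
  have c\<alpha>2: "continuous_on UNIV \<alpha>2"
    unfolding \<alpha>2_def[abs_def]
    by (intro continuous_intros continuous_on_compose2[OF B(3)]) auto
  have ode: "4 * s * \<alpha>2 s + 2 * real ?m * \<alpha>1 s = \<mu>\<^sup>2 * \<alpha> s" for s
    unfolding \<alpha>_def \<alpha>1_def \<alpha>2_def B(4)[of "?c * s", symmetric] by (simp add: field_simps)
  have \<alpha>_pos: "\<alpha> s > 0" if "s \<ge> 0" for s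
    unfolding \<alpha>_def using that m by (intro a_circ_series_pos) auto

  define k where "k y = annular_weight ?m \<epsilon> r (norm y)" for y :: 'a
  \<comment> \<open>\<open>h\<close> is the derivative of \<open>q\<close> with respect to \<open>s = |y|\<^sup>2\<close>; the factor 2 is that of \<open>\<nabla>s = 2 y\<close>.
    The absolute value keeps the denominator positive for negative \<open>s\<close>.\<close>
  define h where "h s = annular_weight ?m \<epsilon> r (sqrt s) / (2 * (\<alpha> \<bar>s\<bar>)\<^sup>2)" for s
  have ch: "continuous_on UNIV h"
    unfolding h_def[abs_def] using \<alpha>_pos[OF abs_ge_zero] \<epsilon>
    by (intro continuous_intros continuous_on_compose2[OF c\<alpha>(1)]) (auto simp: less_imp_neq[symmetric])
  have h0: "h s = 0" if "s \<ge> r\<^sup>2" for s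
  proof -
    have "sqrt s \<ge> r" using that by (rule real_le_rsqrt)
    then show ?thesis using \<epsilon> r by (simp add: h_def annular_weight_eq_0)
  qed
  have "r\<^sup>2 > 0" using \<epsilon> r by simp
  obtain Q where Q: "\<And>s. s \<ge> 0 \<Longrightarrow> (Q has_real_derivative h s) (at s)" "\<And>s. s \<ge> r\<^sup>2 \<Longrightarrow> Q s = 0"
    using continuous_antiderivative_vanishing_above[OF ch h0 \<open>r\<^sup>2 > 0\<close>] by blast

  define A where "A y = \<alpha> (y \<bullet> y)" for y :: 'a
  define dA where "dA b y = \<alpha>1 (y \<bullet> y) * (2 * (y \<bullet> b))" for b y :: 'a
  define ddA where "ddA b y = \<alpha>2 (y \<bullet> y) * (2 * (y \<bullet> b)) * (2 * (y \<bullet> b)) + 2 * \<alpha>1 (y \<bullet> y)" for b y :: 'a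
  define q where "q y = Q (y \<bullet> y)" for y :: 'a
  define dq where "dq b y = h (y \<bullet> y) * (2 * (y \<bullet> b))" for b y :: 'a
  define w where "w y = v y / A y" for y
  \<comment> \<open>\<open>F\<close> has the components of \<open>A\<^sup>2 \<nabla>w\<close>, written so that only second derivatives of \<open>v\<close> and \<open>A\<close>
    appear when it is differentiated.\<close>
  define F where "F b y = A y * dv b y - v y * dA b y" for b y
  define dF where "dF b y = A y * ddv b y - v y * ddA b y" for b y
  define E where "E b y = F b y * q y - w y * k y * (y \<bullet> b)" for b y
  let ?dk = "annular_weight_deriv ?m \<epsilon> r"

  have A_pos: "A y > 0" for y
    unfolding A_def by (rule \<alpha>_pos) auto
  have w_eq: "v y / a_circ ?m (\<mu> * norm y) = w y" for y
    using m by (simp add: w_def A_def \<alpha>_def a_circ_eq_series power_mult_distrib power2_norm_eq_inner mult_ac)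

  have lA: "((\<lambda>t. A (y + t *\<^sub>R b)) has_real_derivative dA b y) (at 0)" for y b
    unfolding A_def dA_def by (rule has_real_derivative_radial_line[OF \<alpha>])
  have lq: "((\<lambda>t. q (y + t *\<^sub>R b)) has_real_derivative dq b y) (at 0)" for y b
    unfolding q_def dq_def by (rule has_real_derivative_radial_line[OF Q(1)]) auto
  have li: "((\<lambda>t. (y + t *\<^sub>R b) \<bullet> b) has_real_derivative 1) (at 0)" if b: "b \<in> Basis" for y b :: 'a
    using b by (auto intro!: derivative_eq_intros simp: inner_add_left)
  have ldA: "((\<lambda>t. dA b (y + t *\<^sub>R b)) has_real_derivative ddA b y) (at 0)" if b: "b \<in> Basis" for y b
    unfolding dA_def ddA_def
    by (rule DERIV_cong[OF DERIV_mult[OF has_real_derivative_radial_line[OF \<alpha>1] DERIV_cmult[OF li[OF b]]]])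
       (simp add: mult_ac)
  have lF: "((\<lambda>t. F b (y + t *\<^sub>R b)) has_real_derivative dF b y) (at 0)" if b: "b \<in> Basis" "norm y < R" for y b
    unfolding F_def dF_def
    by (rule DERIV_cong[OF DERIV_diff[OF DERIV_mult[OF lA dv[OF b]] DERIV_mult[OF v[OF b] ldA[OF b(1)]]]])
       (simp add: algebra_simps)
  have lw: "((\<lambda>t. w (y + t *\<^sub>R b)) has_real_derivative F b y / (A y)\<^sup>2) (at 0)" if b: "b \<in> Basis" "norm y < R" for y b
    unfolding w_def F_def
    by (rule DERIV_cong[OF DERIV_divide[OF v[OF b] lA]])
       (use A_pos in \<open>auto simp: less_imp_neq[symmetric] mult_ac power2_eq_square\<close>)

  have cA: "continuous_on S A" for S
    unfolding A_def[abs_def] by (intro continuous_on_compose2[OF c\<alpha>(1)] continuous_intros) auto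
  have cdA: "continuous_on S (dA b)" for S b
    unfolding dA_def[abs_def] by (intro continuous_on_compose2[OF c\<alpha>(2)] continuous_intros) auto
  have cddA: "continuous_on S (ddA b)" for S b
    unfolding ddA_def[abs_def]
    by (intro continuous_on_compose2[OF c\<alpha>(2)] continuous_on_compose2[OF c\<alpha>2] continuous_intros) auto
  have cdq: "continuous_on S (dq b)" for S b
    unfolding dq_def[abs_def] by (intro continuous_on_compose2[OF ch] continuous_intros) auto
  have "continuous_on {0..} Q"
    using Q(1) by (intro DERIV_continuous_on[of _ _ h]) (auto intro: DERIV_subset)
  then have cq: "continuous_on S q" for S
    unfolding q_def[abs_def] by (rule continuous_on_compose2) (auto intro!: continuous_intros)
  have ck: "continuous_on S k" for S
    unfolding k_def[abs_def] using \<epsilon> by (intro continuous_intros)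
  have cF: "continuous_on (ball 0 R) (F b)" if "b \<in> Basis" for b
    unfolding F_def[abs_def] by (intro continuous_intros cA cdA cv cdv that)
  have cdF: "continuous_on (ball 0 R) (dF b)" if "b \<in> Basis" for b
    unfolding dF_def[abs_def] by (intro continuous_intros cA cddA cv cddv that)
  have cw: "continuous_on (ball 0 R) w"
    unfolding w_def[abs_def] using A_pos
    by (intro continuous_intros cA cv) (auto simp: less_imp_neq[symmetric])
  have cdw: "continuous_on (ball 0 R) (\<lambda>y. F b y / (A y)\<^sup>2)" if "b \<in> Basis" for b
    using A_pos by (intro continuous_intros cF cA that) (auto simp: less_imp_neq[symmetric])
  have cE: "continuous_on (ball 0 R) (E b)" if "b \<in> Basis" for b
    unfolding E_def[abs_def] by (intro continuous_intros cF cq cw ck that)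

  have E0: "E b y = 0" if "norm y \<ge> r" for b y
  proof -
    have "y \<bullet> y \<ge> r\<^sup>2"
      using that \<epsilon> r by (simp flip: power2_norm_eq_inner add: power_mono)
    then show ?thesis
      using that \<epsilon> r Q(2) by (simp add: E_def q_def k_def annular_weight_eq_0)
  qed

  \<comment> \<open>A ball slightly larger than the support of the field: an increment shorter than \<open>\<rho> - r\<close> either
    stays inside it or joins two points at which the field vanishes.\<close>
  define \<rho> where "\<rho> = (r + R) / 2"
  have \<rho>: "r < \<rho>" "\<rho> < R"
    using r by (auto simp: \<rho>_def)
  let ?S = "cball 0 \<rho> :: 'a set"
  have bdd: "bounded (f ` ?S)" if "continuous_on (ball 0 R) f" for f :: "'a \<Rightarrow> real"
    using \<rho> by (intro compact_imp_bounded compact_continuous_image continuous_on_subset[OF that]) auto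
  have lipE: "dir_lipschitz b ?S (E b)" if b: "b \<in> Basis" for b
  proof -
    obtain C where "C-lipschitz_on UNIV k"
      unfolding k_def[abs_def] using lipschitz_on_annular_weight[OF \<epsilon> r(1)] by blast
    then have 1: "dir_lipschitz b ?S k"
      by (intro dir_lipschitz_if_lipschitz_on[of C]) (rule lipschitz_on_subset, auto)
    have 2: "dir_lipschitz b ?S q"
      by (rule dir_lipschitz_if_derivative[where f' = "dq b"]) (auto intro: lq bdd cdq)
    have 3: "dir_lipschitz b ?S (F b)"
      by (rule dir_lipschitz_if_derivative[where f' = "dF b"]) (use \<rho> in \<open>auto intro: lF bdd cdF b\<close>)
    have 4: "dir_lipschitz b ?S w"
      by (rule dir_lipschitz_if_derivative[where f' = "\<lambda>y. F b y / (A y)\<^sup>2"])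
         (use \<rho> in \<open>auto intro: lw bdd cdw b\<close>)
    have 5: "dir_lipschitz b ?S (\<lambda>y. y \<bullet> b)"
      by (rule dir_lipschitz_if_derivative[where f' = "\<lambda>y. 1"]) (auto intro: li b bdd continuous_intros)
    show ?thesis
      unfolding E_def[abs_def]
      by (intro dir_lipschitz_diff dir_lipschitz_mult 1 2 3 4 5 bdd cF cq cw ck continuous_intros b)
  qed

  define G where "G b y = (if norm y < R then E b y else 0)" for b y
  define d where "d y = indicator (ball 0 \<epsilon>) y * w y / \<epsilon> ^ ?m - indicator (ball 0 r) y * w y / r ^ ?m" for y
  have G0: "G b y = 0" if "norm y \<ge> r" for b y
    using E0[OF that] by (simp add: G_def)
  have "(\<integral>y. d y \<partial>lborel) = 0"
  proof (rule integral_divergence_eq_0)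
    fix b :: 'a assume b: "b \<in> Basis"
    have "continuous_on ?S (E b)"
      using \<rho> by (intro continuous_on_subset[OF cE[OF b]]) auto
    then have "integrable lborel (\<lambda>y. indicator ?S y *\<^sub>R E b y)"
      by (intro borel_integrable_compact) auto
    also have "(\<lambda>y. indicator ?S y *\<^sub>R E b y) = G b"
      using \<rho> E0 by (auto simp: G_def fun_eq_iff indicator_def)
    finally show "integrable lborel (G b)" .
    show "G b y = 0" if "norm y \<ge> r" for y
      by (rule G0[OF that])
    obtain C where C: "\<And>y t. y \<in> ?S \<Longrightarrow> y + t *\<^sub>R b \<in> ?S \<Longrightarrow> \<bar>E b (y + t *\<^sub>R b) - E b y\<bar> \<le> C * \<bar>t\<bar>"
      using lipE[OF b] unfolding dir_lipschitz_def by blast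
    show "\<exists>C. \<forall>y t. \<bar>t\<bar> < \<rho> - r \<longrightarrow> \<bar>G b (y + t *\<^sub>R b) - G b y\<bar> \<le> C * \<bar>t\<bar>"
    proof (intro exI[of _ "\<bar>C\<bar>"] allI impI)
      fix y t assume t: "\<bar>t\<bar> < \<rho> - r"
      let ?z = "y + t *\<^sub>R b"
      have n: "\<bar>norm ?z - norm y\<bar> \<le> \<bar>t\<bar>"
        using norm_triangle_ineq3[of ?z y] b by simp
      show "\<bar>G b ?z - G b y\<bar> \<le> \<bar>C\<bar> * \<bar>t\<bar>"
      proof (cases "norm y \<le> \<rho> \<and> norm ?z \<le> \<rho>")
        case True
        then have "\<bar>G b ?z - G b y\<bar> \<le> C * \<bar>t\<bar>"
          using \<rho> C[of y t] by (simp add: G_def)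
        also have "\<dots> \<le> \<bar>C\<bar> * \<bar>t\<bar>"
          by (intro mult_right_mono) auto
        finally show ?thesis .
      next
        case False
        then have "norm y \<ge> r" "norm ?z \<ge> r"
          using n t by linarith+
        then show ?thesis by (simp add: G0)
      qed
    qed
  next
    show "\<rho> - r > 0" using \<rho> by simp
    \<comment> \<open>The weight \<open>k\<close> has its kinks on these two spheres.\<close>
    have "AE y in lborel. y \<notin> sphere 0 \<epsilon> \<union> sphere (0::'a) r"
    proof (rule AE_not_in)
      have "sphere 0 \<rho> \<in> null_sets (lborel :: 'a measure)" for \<rho>
        using negligible_sphere[of "0::'a" \<rho>]
        by (auto simp: null_sets_completion_iff negligible_iff_null_sets negligible_convex_frontier)
      then show "sphere 0 \<epsilon> \<union> sphere (0::'a) r \<in> null_sets lborel"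
        by blast
    qed
    then show "AE y in lborel. \<exists>g. (\<forall>b\<in>Basis. ((\<lambda>t. G b (y + t *\<^sub>R b)) has_real_derivative g b) (at 0)) \<and>
                 (\<Sum>b\<in>Basis. g b) = d y"
    proof eventually_elim
      case (elim y)
      then have y: "norm y \<noteq> \<epsilon>" "norm y \<noteq> r" by auto
      show ?case
      proof (cases "norm y < R")
        case True
        let ?g = "\<lambda>b. dF b y * q y - w y * (?dk b y * (y \<bullet> b) + k y)"
        have "((\<lambda>t. G b (y + t *\<^sub>R b)) has_real_derivative ?g b) (at 0)" if b: "b \<in> Basis" for b
        proof -
          have ev: "\<forall>\<^sub>F t in nhds 0. G b (y + t *\<^sub>R b) = E b (y + t *\<^sub>R b)"
            by (rule eventually_mono[OF eventually_norm_line[of "{..<R}" y b]])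
               (use True in \<open>auto simp: G_def\<close>)
          have lk: "((\<lambda>t. k (y + t *\<^sub>R b)) has_real_derivative ?dk b y) (at 0)"
            unfolding k_def using m \<epsilon> r y by (intro has_real_derivative_annular_weight_line) auto
          have "((\<lambda>t. E b (y + t *\<^sub>R b)) has_real_derivative
             dF b y * q y + dq b y * F b y - ((F b y / (A y)\<^sup>2 * k y + ?dk b y * w y) * (y \<bullet> b) + w y * k y)) (at 0)"
            unfolding E_def
            by (rule DERIV_cong[OF DERIV_diff[OF DERIV_mult[OF lF[OF b True] lq]
                  DERIV_mult[OF DERIV_mult[OF lw[OF b True] lk] li[OF b]]]]) simp
          moreover have "dq b y = k y / (A y)\<^sup>2 * (y \<bullet> b)"
            by (simp add: dq_def h_def k_def A_def norm_eq_sqrt_inner)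
          ultimately have "((\<lambda>t. E b (y + t *\<^sub>R b)) has_real_derivative ?g b) (at 0)"
            by (simp add: algebra_simps)
          then show ?thesis
            unfolding DERIV_cong_ev[OF refl ev refl] .
        qed
        moreover have "(\<Sum>b\<in>Basis. ?g b) = d y"
        proof -
          have "(\<Sum>b\<in>Basis. ddA b y) = (\<Sum>b\<in>Basis. 4 * \<alpha>2 (y \<bullet> y) * ((y \<bullet> b) * (y \<bullet> b)) + 2 * \<alpha>1 (y \<bullet> y))"
            by (simp add: ddA_def mult_ac)
          also have "\<dots> = 4 * (y \<bullet> y) * \<alpha>2 (y \<bullet> y) + 2 * real ?m * \<alpha>1 (y \<bullet> y)"
            unfolding sum.distrib sum_distrib_left[symmetric] euclidean_inner[symmetric] by simp
          also have "\<dots> = \<mu>\<^sup>2 * A y"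
            unfolding A_def by (rule ode)
          finally have 1: "(\<Sum>b\<in>Basis. dF b y) = 0"
            using pde[OF True] by (simp add: dF_def sum_subtractf flip: sum_distrib_left)
          have 2: "(\<Sum>b\<in>Basis. ?dk b y * (y \<bullet> b) + k y) =
              indicator (ball 0 r) y / r ^ ?m - indicator (ball 0 \<epsilon>) y / \<epsilon> ^ ?m"
            unfolding k_def by (rule divergence_annular_weight[OF \<epsilon> r(1) y])
          have 3: "(\<Sum>b\<in>Basis. ?g b) = (\<Sum>b\<in>Basis. dF b y) * q y - w y * (\<Sum>b\<in>Basis. ?dk b y * (y \<bullet> b) + k y)"
            by (simp only: sum_subtractf sum_distrib_left sum_distrib_right)
          show ?thesis
            unfolding 3 1 2 by (simp add: d_def right_diff_distrib mult.commute)
        qed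
        ultimately show ?thesis
          by (intro exI[of _ ?g] conjI ballI)
      next
        case False
        have "((\<lambda>t. G b (y + t *\<^sub>R b)) has_real_derivative 0) (at 0)" for b
        proof -
          have ev: "\<forall>\<^sub>F t in nhds 0. G b (y + t *\<^sub>R b) = 0"
            by (rule eventually_mono[OF eventually_norm_line[of "{r<..}" y b]])
               (use False r in \<open>auto intro: G0\<close>)
          show ?thesis
            unfolding DERIV_cong_ev[OF refl ev refl] by simp
        qed
        moreover have "d y = 0"
          using False r by (simp add: d_def)
        ultimately show ?thesis
          by (intro exI[of _ "\<lambda>_. 0"]) simp
      qed
    qed
    have "(\<lambda>y. indicator (ball 0 s) y *\<^sub>R w y) \<in> borel_measurable borel" if "s < R" for s
      using that by (intro borel_measurable_continuous_on_indicator continuous_on_subset[OF cw]) auto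
    from this[of \<epsilon>] this[of r] show "d \<in> borel_measurable borel"
      unfolding d_def[abs_def] using r by simp
  qed
  moreover have "(\<integral>y. d y \<partial>lborel) =
      (LINT y:ball 0 \<epsilon>|lborel. w y) / \<epsilon> ^ ?m - (LINT y:ball 0 r|lborel. w y) / r ^ ?m"
    using set_integrable_ball_continuous[OF cw, of \<epsilon>] set_integrable_ball_continuous[OF cw, of r] r
    unfolding d_def set_lebesgue_integral_def set_integrable_def by simp
  ultimately show ?thesis
    by (simp add: w_eq)
qed

section \<open>From ball means to sphere means\<close>

lemma set_integrable_lborel_const:
  assumes "S \<in> sets borel" "bounded S"
  shows "set_integrable lborel S (\<lambda>_::'a::euclidean_space. c::real)"
  using assms emeasure_bounded_finite[of S]
  unfolding set_integrable_def by (intro integrable_scaleR_left integrable_real_indicator) auto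

lemma set_integral_le_const:
  fixes f :: "'a::euclidean_space \<Rightarrow> real"
  assumes S: "S \<in> sets borel" "bounded S" and f: "set_integrable lborel S f"
    and le: "\<And>y. y \<in> S \<Longrightarrow> f y \<le> c"
  shows "(LINT y:S|lborel. f y) \<le> c * measure lborel S"
proof -
  have "(LINT y:S|lborel. f y) \<le> (LINT y:S|lborel. c)"
    by (rule set_integral_mono[OF f set_integrable_lborel_const[OF S] le])
  also have "\<dots> = c * measure lborel S"
    using S emeasure_bounded_finite[of S] by (subst set_integral_const) auto
  finally show ?thesis .
qed

lemma set_integral_abs_le_const:
  fixes f :: "'a::euclidean_space \<Rightarrow> real"
  assumes S: "S \<in> sets borel" "bounded S" and f: "set_integrable lborel S f"
    and le: "\<And>y. y \<in> S \<Longrightarrow> \<bar>f y\<bar> \<le> c"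
  shows "\<bar>LINT y:S|lborel. f y\<bar> \<le> c * measure lborel S"
proof -
  have "(LINT y:S|lborel. f y) \<le> c * measure lborel S"
    by (rule set_integral_le_const[OF S f]) (use le in force)
  moreover have "(LINT y:S|lborel. - f y) \<le> c * measure lborel S"
  proof (rule set_integral_le_const[OF S])
    show "set_integrable lborel S (\<lambda>y. - f y)"
      using f unfolding set_integrable_def by simp
    show "- f y \<le> c" if "y \<in> S" for y
      using le[OF that] by linarith
  qed
  ultimately show ?thesis
    by (simp add: set_integral_uminus[OF f])
qed

lemma set_integrable_radial:
  fixes g :: "'a::euclidean_space \<Rightarrow> real"
  assumes g: "continuous_on (sphere 0 R) g" and R: "R > 0"
    and S: "S \<in> sets borel" "bounded S" "0 \<notin> S"
  shows "set_integrable lborel S (\<lambda>y. g ((R / norm y) *\<^sub>R y))"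
proof -
  let ?f = "\<lambda>y. g ((R / norm y) *\<^sub>R y)"
  have "continuous_on (- {0}) ?f"
    using R by (intro continuous_on_compose2[OF g] continuous_intros) (auto split: if_splits)
  then have m: "(\<lambda>y. indicator (- {0}) y *\<^sub>R ?f y) \<in> borel_measurable borel"
    by (intro borel_measurable_continuous_on_indicator) auto
  have "bounded (g ` sphere 0 R)"
    using g by (intro compact_imp_bounded compact_continuous_image) auto
  then obtain B where B: "\<And>z. z \<in> sphere 0 R \<Longrightarrow> norm (g z) \<le> B"
    unfolding bounded_iff by blast
  have "integrable lborel (\<lambda>y. indicator S y *\<^sub>R (indicator (- {0}) y *\<^sub>R ?f y))"
  proof (rule integrableI_bounded_set_indicator)
    show "AE y in lborel. y \<in> S \<longrightarrow> norm (indicator (- {0}) y *\<^sub>R ?f y) \<le> B"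
      using R S(3) by (intro AE_I2) (auto simp: indicator_def intro!: B[unfolded real_norm_def])
  qed (use S m emeasure_bounded_finite[of S] in auto)
  also have "(\<lambda>y. indicator S y *\<^sub>R (indicator (- {0}) y *\<^sub>R ?f y)) = (\<lambda>y. indicator S y *\<^sub>R ?f y)"
    using S(3) by (auto simp: indicator_def fun_eq_iff)
  finally show ?thesis
    unfolding set_integrable_def .
qed

text \<open>
  The integrand is constant along rays, so shrinking the ball only contributes the Jacobian
  of the dilation.
\<close>

lemma set_integral_radial_scale:
  fixes g :: "'a::euclidean_space \<Rightarrow> real"
  assumes g: "continuous_on (sphere 0 R) g" and R: "R > 0" and \<rho>: "\<rho> > 0"
  shows "(LINT y:ball 0 \<rho> - {0}|lborel. g ((R / norm y) *\<^sub>R y)) =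
    (\<rho> / R) ^ DIM('a) * (LINT y:ball 0 R - {0}|lborel. g ((R / norm y) *\<^sub>R y))"
proof -
  let ?f = "\<lambda>\<rho> y. indicator (ball 0 \<rho> - {0}) y *\<^sub>R g ((R / norm y) *\<^sub>R y)"
  have "bounded (ball 0 \<rho> - {0::'a})"
    by (rule bounded_subset[OF bounded_ball]) auto
  then have "integrable lborel (?f \<rho>)"
    using set_integrable_radial[OF g R, of "ball 0 \<rho> - {0}"] unfolding set_integrable_def by simp
  then have "?f \<rho> \<in> borel_measurable borel"
    using borel_measurable_integrable by fastforce
  then have "(\<integral>y. ?f \<rho> y \<partial>lborel) = \<bar>\<rho> / R\<bar> ^ DIM('a) * (\<integral>y. ?f \<rho> (0 + (\<rho> / R) *\<^sub>R y) \<partial>lborel)"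
    using R \<rho> by (intro integral_lborel_affine) auto
  also have "(\<lambda>y. ?f \<rho> (0 + (\<rho> / R) *\<^sub>R y)) = ?f R"
    using R \<rho> by (auto simp: fun_eq_iff indicator_def field_simps)
  finally show ?thesis
    using R \<rho> unfolding set_lebesgue_integral_def by simp
qed

lemma measure_punctured_ball:
  "r \<ge> 0 \<Longrightarrow> measure lborel (ball (0::'a::euclidean_space) r - {0}) = unit_ball_vol (real DIM('a)) * r ^ DIM('a)"
  by (subst measure_Diff_null_set) (auto simp: content_ball null_sets_def)

lemma eq_if_abs_diff_le_mult:
  fixes a b C :: real
  assumes "C > 0" and "\<And>\<eta>. \<eta> > 0 \<Longrightarrow> \<bar>a - b\<bar> \<le> \<eta> * C"
  shows "a = b"
proof -
  have "\<bar>a - b\<bar> \<le> 0 + e" if "e > 0" for e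
    using assms(2)[of "e / C"] assms(1) that by simp
  then have "\<bar>a - b\<bar> \<le> 0"
    by (rule field_le_epsilon)
  then show ?thesis by simp
qed

text \<open>
  Ball means that do not depend on the radius equal their limit as the radius tends to zero.
\<close>

lemma ball_mean_eq_center:
  fixes w :: "'a::euclidean_space \<Rightarrow> real"
  assumes w: "continuous_on (ball 0 R) w" and r: "0 < r" "r < R"
    and const: "\<And>\<epsilon>. 0 < \<epsilon> \<Longrightarrow> \<epsilon> < r \<Longrightarrow>
      (LINT y:ball 0 r|lborel. w y) / r ^ DIM('a) = (LINT y:ball 0 \<epsilon>|lborel. w y) / \<epsilon> ^ DIM('a)"
  shows "(LINT y:ball 0 r|lborel. w y) = unit_ball_vol (real DIM('a)) * r ^ DIM('a) * w 0"
proof -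
  let ?\<omega> = "unit_ball_vol (real DIM('a))"
  define I where "I = (LINT y:ball 0 r|lborel. w y) / r ^ DIM('a)"
  have \<omega>: "?\<omega> > 0" by simp
  have "\<bar>I - ?\<omega> * w 0\<bar> \<le> \<eta> * ?\<omega>" if \<eta>: "\<eta> > 0" for \<eta>
  proof -
    have "isCont w 0"
      using w r by (simp add: continuous_on_eq_continuous_at)
    then obtain \<delta> where \<delta>: "\<delta> > 0" "\<And>y. norm y < \<delta> \<Longrightarrow> \<bar>w y - w 0\<bar> < \<eta>"
      using \<eta> unfolding continuous_at_eps_delta by (auto simp: dist_norm)
    define \<epsilon> where "\<epsilon> = min \<delta> r / 2"
    have \<epsilon>: "0 < \<epsilon>" "\<epsilon> < r" "\<epsilon> < \<delta>" "\<epsilon> < R"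
      using \<delta> r by (auto simp: \<epsilon>_def)
    have i: "set_integrable lborel (ball 0 \<epsilon>) w" "set_integrable lborel (ball 0 \<epsilon>) (\<lambda>_. w 0)"
      using set_integrable_ball_continuous[OF w \<epsilon>(4)] set_integrable_lborel_const[of "ball 0 \<epsilon>"] by auto
    have "\<bar>LINT y:ball 0 \<epsilon>|lborel. w y - w 0\<bar> \<le> \<eta> * measure lborel (ball (0::'a) \<epsilon>)"
      using \<epsilon> \<delta>(2) by (intro set_integral_abs_le_const set_integral_diff(1) i) (auto intro: less_imp_le)
    also have "(LINT y:ball 0 \<epsilon>|lborel. w y - w 0) =
        (LINT y:ball 0 \<epsilon>|lborel. w y) - ?\<omega> * \<epsilon> ^ DIM('a) * w 0"
      using \<epsilon> emeasure_bounded_finite[of "ball (0::'a) \<epsilon>"]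
      by (subst set_integral_diff(2)[OF i], subst set_integral_const) (auto simp: content_ball)
    finally have "\<bar>(LINT y:ball 0 \<epsilon>|lborel. w y) - ?\<omega> * \<epsilon> ^ DIM('a) * w 0\<bar> \<le> \<eta> * (?\<omega> * \<epsilon> ^ DIM('a))"
      using \<epsilon> by (simp add: content_ball)
    moreover have "(LINT y:ball 0 \<epsilon>|lborel. w y) = I * \<epsilon> ^ DIM('a)"
      using const[OF \<epsilon>(1,2)] \<epsilon> by (simp add: I_def)
    ultimately have "\<bar>(I - ?\<omega> * w 0) * \<epsilon> ^ DIM('a)\<bar> \<le> \<eta> * ?\<omega> * \<epsilon> ^ DIM('a)"
      by (simp add: algebra_simps)
    then show ?thesis
      using \<epsilon> by (simp add: abs_mult)
  qed
  then have "I = ?\<omega> * w 0"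
    by (rule eq_if_abs_diff_le_mult[OF \<omega>])
  then show ?thesis
    using r by (simp add: I_def field_simps)
qed

text \<open>
  On a thin shell next to the sphere, \<open>w\<close> differs by at most \<open>\<eta>\<close> from its value at the radial
  projection. The shell integral of \<open>w\<close> is known as a difference of two ball integrals, and that of the
  projected function is the volume fraction of the shell times the full integral. Division by the
  volume of the shell leaves an error of order \<open>\<eta>\<close>.
\<close>

lemma radial_integral_eq_center:
  fixes w :: "'a::euclidean_space \<Rightarrow> real"
  assumes w: "continuous_on (cball 0 R) w" and R: "R > 0"
    and mean: "\<And>r. 0 < r \<Longrightarrow> r < R \<Longrightarrow>
      (LINT y:ball 0 r|lborel. w y) = unit_ball_vol (real DIM('a)) * r ^ DIM('a) * w 0"
  shows "(LINT y:ball 0 R - {0}|lborel. w ((R / norm y) *\<^sub>R y)) =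
    unit_ball_vol (real DIM('a)) * R ^ DIM('a) * w 0"
proof -
  let ?\<omega> = "unit_ball_vol (real DIM('a))"
  let ?f = "\<lambda>y. w ((R / norm y) *\<^sub>R y)"
  let ?J = "(LINT y:ball 0 R - {0}|lborel. ?f y) / R ^ DIM('a)"
  have \<omega>: "?\<omega> > 0" by simp
  have ws: "continuous_on (sphere 0 R) w" and wb: "continuous_on (ball 0 R) w"
    using w by (auto intro: continuous_on_subset)
  have "\<bar>?J - ?\<omega> * w 0\<bar> \<le> \<eta> * ?\<omega>" if \<eta>: "\<eta> > 0" for \<eta>
  proof -
    have "uniformly_continuous_on (cball 0 R) w"
      using w by (intro compact_uniformly_continuous) auto
    then obtain \<delta> where \<delta>: "\<delta> > 0"
      "\<And>y z. norm y \<le> R \<Longrightarrow> norm z \<le> R \<Longrightarrow> norm (z - y) < \<delta> \<Longrightarrow> \<bar>w z - w y\<bar> < \<eta>"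
      using \<eta> unfolding uniformly_continuous_on_def by (force simp: dist_norm)
    \<comment> \<open>The shell \<open>\<rho> \<le> |y| < r\<close> keeps the outer radius below \<open>R\<close>, where the ball means are known.\<close>
    define \<rho> where "\<rho> = max (R / 2) (R - \<delta> / 2)"
    define r where "r = (\<rho> + R) / 2"
    have \<rho>: "0 < \<rho>" "\<rho> < r" "r < R" "R - \<rho> < \<delta>" "0 < r"
      using R \<delta> by (auto simp: \<rho>_def r_def)
    let ?T = "ball 0 r - ball 0 \<rho> :: 'a set"
    have T: "?T \<in> sets borel" "bounded ?T" "0 \<notin> ?T"
      using \<rho> by (auto intro: bounded_subset[of "ball 0 r"])
    have split: "ball 0 \<rho> \<union> ?T = ball 0 r" "(ball 0 \<rho> - {0}) \<union> ?T = ball 0 r - {0}"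
      using \<rho> by auto
    have iw: "set_integrable lborel ?T w"
      by (rule set_integrable_subset[OF set_integrable_ball_continuous[OF wb \<rho>(3)]]) auto
    have iF: "set_integrable lborel ?T ?f"
      by (rule set_integrable_radial[OF ws R T])
    have d: "r ^ DIM('a) - \<rho> ^ DIM('a) > 0"
      using \<rho> by (simp add: power_strict_mono)
    have mT: "measure lborel ?T = ?\<omega> * (r ^ DIM('a) - \<rho> ^ DIM('a))"
      using \<rho> emeasure_bounded_finite[of "ball (0::'a) r"]
      by (subst measure_Diff) (auto simp: content_ball right_diff_distrib)
    have "\<bar>LINT y:?T|lborel. ?f y - w y\<bar> \<le> \<eta> * measure lborel ?T"
    proof (rule set_integral_abs_le_const[OF T(1,2)])
      show "set_integrable lborel ?T (\<lambda>y. ?f y - w y)"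
        by (rule set_integral_diff(1)[OF iF iw])
      fix y assume "y \<in> ?T"
      then have y: "\<rho> \<le> norm y" "norm y < r" "norm y > 0"
        using \<rho> by auto
      have "(R / norm y) *\<^sub>R y - y = (R / norm y - 1) *\<^sub>R y"
        by (simp add: algebra_simps)
      also have "norm \<dots> = \<bar>(R / norm y - 1) * norm y\<bar>"
        by (simp add: abs_mult)
      also have "(R / norm y - 1) * norm y = R - norm y"
        using y(3) by (simp add: left_diff_distrib)
      finally have "norm ((R / norm y) *\<^sub>R y - y) < \<delta>"
        using y \<rho> by simp
      then show "\<bar>?f y - w y\<bar> \<le> \<eta>"
        using y \<rho> R by (intro less_imp_le[OF \<delta>(2)]) auto
    qed
    also have "(LINT y:?T|lborel. ?f y - w y) = (LINT y:?T|lborel. ?f y) - (LINT y:?T|lborel. w y)"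
      by (rule set_integral_diff(2)[OF iF iw])
    also have "(LINT y:?T|lborel. w y) = (r ^ DIM('a) - \<rho> ^ DIM('a)) * (?\<omega> * w 0)"
    proof -
      have "(LINT y:ball 0 \<rho> \<union> ?T|lborel. w y) = (LINT y:ball 0 \<rho>|lborel. w y) + (LINT y:?T|lborel. w y)"
        using \<rho> by (intro set_integral_Un iw set_integrable_ball_continuous[OF wb]) auto
      then show ?thesis
        unfolding split(1) using \<rho> by (simp add: mean algebra_simps)
    qed
    also have "(LINT y:?T|lborel. ?f y) = (r ^ DIM('a) - \<rho> ^ DIM('a)) * ?J"
    proof -
      have "(LINT y:(ball 0 \<rho> - {0}) \<union> ?T|lborel. ?f y) =
          (LINT y:ball 0 \<rho> - {0}|lborel. ?f y) + (LINT y:?T|lborel. ?f y)"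
        using \<rho> by (intro set_integral_Un iF set_integrable_radial[OF ws R])
          (auto intro: bounded_subset[of "ball 0 \<rho>"])
      then have "(LINT y:?T|lborel. ?f y) = (LINT y:ball 0 r - {0}|lborel. ?f y) - (LINT y:ball 0 \<rho> - {0}|lborel. ?f y)"
        unfolding split(2) by simp
      also have "\<dots> = (r ^ DIM('a) - \<rho> ^ DIM('a)) * ?J"
        unfolding set_integral_radial_scale[OF ws R \<rho>(5)] set_integral_radial_scale[OF ws R \<rho>(1)]
        by (simp add: power_divide diff_divide_distrib left_diff_distrib)
      finally show ?thesis .
    qed
    also have "(r ^ DIM('a) - \<rho> ^ DIM('a)) * ?J - (r ^ DIM('a) - \<rho> ^ DIM('a)) * (?\<omega> * w 0) =
        (r ^ DIM('a) - \<rho> ^ DIM('a)) * (?J - ?\<omega> * w 0)"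
      by (rule right_diff_distrib[symmetric])
    finally have "(r ^ DIM('a) - \<rho> ^ DIM('a)) * \<bar>?J - ?\<omega> * w 0\<bar> \<le> (r ^ DIM('a) - \<rho> ^ DIM('a)) * (\<eta> * ?\<omega>)"
      unfolding abs_mult mT using d by (simp add: mult_ac)
    then show ?thesis
      using d by (rule mult_left_le_imp_le)
  qed
  then have "?J = ?\<omega> * w 0"
    by (rule eq_if_abs_diff_le_mult[OF \<omega>])
  then show ?thesis
    using R by (simp add: field_simps)
qed

section \<open>The maximum principle and uniqueness\<close>

lemma C1_on_has_partial_deriv:
  assumes "C1_on D f" "b \<in> Basis" "x \<in> D"
  shows "((\<lambda>t. f (x + t *\<^sub>R b)) has_real_derivative partial_deriv b f x) (at 0)"
  using assms unfolding C1_on_def partial_deriv_def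
  by (auto simp: DERIV_deriv_iff_field_differentiable)

lemma closed_ball_subset_closure:
  fixes x :: "'a::euclidean_space"
  assumes "ball x R \<subseteq> D" "R > 0"
  shows "cball x R \<subseteq> closure D"
  using closure_mono[OF assms(1)] assms(2) by simp

text \<open>
  On the sphere of radius \<open>R\<close> the quotient of \<open>v\<close> by \<open>a(\<mu> |y - x|)\<close> is \<open>v\<close> divided by the constant
  \<open>a(\<mu> R)\<close>, and at the centre it is \<open>v(x)\<close>. So the mean value property of the quotient is that of \<open>v\<close> with
  the factor \<open>a(\<mu> R)\<close>. Continuity up to the closure of \<open>D\<close> admits a sphere that meets the boundary.
\<close>

lemma panharmonic_sphere_mean:
  fixes v :: "'a::euclidean_space \<Rightarrow> real"
  assumes m: "DIM('a) \<ge> 2" and v: "panharmonic_on \<mu> D v" and cv: "continuous_on (closure D) v"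
    and R: "R > 0" and D: "ball x R \<subseteq> D"
  shows "sphere_mean v x R = a_circ DIM('a) (\<mu> * R) * v x"
proof -
  let ?\<omega> = "unit_ball_vol (real DIM('a))"
  let ?a = "\<lambda>t. a_circ DIM('a) (\<mu> * t)"
  let ?p = "\<lambda>b y. partial_deriv b v (x + y)"
  let ?pp = "\<lambda>b y. partial_deriv b (partial_deriv b v) (x + y)"
  define w where "w y = v (x + y) / ?a (norm y)" for y
  have a_pos: "?a t > 0" for t
    using m by (simp add: a_circ_eq_series a_circ_series_pos)
  obtain B1 where "\<And>z. (a_circ_series DIM('a) has_real_derivative B1 z) (at z)"
    using a_circ_series_ode[OF m] by metis
  then have "continuous_on UNIV (a_circ_series DIM('a))"
    by (intro DERIV_continuous_on) auto
  then have ca: "continuous_on S (\<lambda>y::'a. ?a (norm y))" for S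
    unfolding a_circ_eq_series[OF m]
    by (rule continuous_on_compose2) (auto intro!: continuous_intros)
  have sub: "cball x R \<subseteq> closure D"
    by (rule closed_ball_subset_closure[OF D R])
  have inD: "x + y \<in> D" if "norm y < R" for y
    using that D by (auto simp: dist_norm)
  have cw: "continuous_on (cball 0 R) w"
    unfolding w_def[abs_def] using a_pos sub
    by (intro continuous_intros ca continuous_on_compose2[OF cv])
       (auto simp: dist_norm less_imp_neq[symmetric])
  have C1: "C1_on D v" "\<And>b. b \<in> Basis \<Longrightarrow> C1_on D (partial_deriv b v)"
    using v unfolding panharmonic_on_def C2_on_def by auto
  have shift: "continuous_on (ball 0 R) (\<lambda>y. f (x + y))" if "continuous_on D f" for f :: "'a \<Rightarrow> real"
    using D by (intro continuous_on_compose2[OF that] continuous_intros) auto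
  have scaled: "(LINT y:ball 0 r|lborel. w y) / r ^ DIM('a) = (LINT y:ball 0 \<epsilon>|lborel. w y) / \<epsilon> ^ DIM('a)"
    if "0 < \<epsilon>" "\<epsilon> < r" "r < R" for \<epsilon> r
    unfolding w_def
  proof (rule panharmonic_quotient_ball_mean[OF m that, where dv = ?p and ddv = ?pp])
    fix b y :: 'a assume b: "b \<in> Basis" "norm y < R"
    show "((\<lambda>t. v (x + (y + t *\<^sub>R b))) has_real_derivative ?p b y) (at 0)"
      using C1_on_has_partial_deriv[OF C1(1) b(1) inD[OF b(2)]] by (simp add: add.assoc)
    show "((\<lambda>t. ?p b (y + t *\<^sub>R b)) has_real_derivative ?pp b y) (at 0)"
      using C1_on_has_partial_deriv[OF C1(2)[OF b(1)] b(1) inD[OF b(2)]] by (simp add: add.assoc)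
  next
    show "continuous_on (ball 0 R) (\<lambda>y. v (x + y))"
      using C1(1) by (intro shift) (simp add: C1_on_def)
    show "continuous_on (ball 0 R) (?p b)" "continuous_on (ball 0 R) (?pp b)" if "b \<in> Basis" for b
      using C1(2)[OF that] that by (auto intro!: shift simp: C1_on_def)
    show "(\<Sum>b\<in>Basis. ?pp b y) = \<mu>\<^sup>2 * v (x + y)" if "norm y < R" for y
      using v inD[OF that] unfolding panharmonic_on_def laplacian_def by auto
  qed
  have "(LINT y:ball 0 R - {0}|lborel. w ((R / norm y) *\<^sub>R y)) = ?\<omega> * R ^ DIM('a) * w 0"
  proof (rule radial_integral_eq_center[OF cw R])
    fix r assume r: "0 < r" "r < R"
    have "continuous_on (ball 0 R) w"
      by (rule continuous_on_subset[OF cw]) auto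
    then show "(LINT y:ball 0 r|lborel. w y) = ?\<omega> * r ^ DIM('a) * w 0"
      using r scaled by (intro ball_mean_eq_center) auto
  qed
  moreover have "w 0 = v x"
    using m by (simp add: w_def a_circ_0)
  moreover have "(LINT y:ball 0 R - {0}|lborel. v (x + (R / norm y) *\<^sub>R y)) =
      ?a R * (LINT y:ball 0 R - {0}|lborel. w ((R / norm y) *\<^sub>R y))"
    unfolding set_integral_mult_right[symmetric] using R a_pos[of R]
    by (intro set_lebesgue_integral_cong) (auto simp: w_def)
  moreover have "sphere_mean v x R = (LINT y:ball 0 R - {0}|lborel. v (x + (R / norm y) *\<^sub>R y)) / (?\<omega> * R ^ DIM('a))"
    using sub by (intro sphere_mean_eq R continuous_on_subset[OF cv]) auto
  moreover have "?\<omega> \<noteq> 0"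
    using unit_ball_vol_pos[of "real DIM('a)"] by linarith
  ultimately show ?thesis
    using R by simp
qed

lemma sphere_mean_le:
  fixes w :: "'a::euclidean_space \<Rightarrow> real"
  assumes R: "R > 0" and w: "continuous_on (sphere x R) w" and le: "\<And>y. y \<in> sphere x R \<Longrightarrow> w y \<le> c"
  shows "sphere_mean w x R \<le> c"
proof -
  let ?S = "ball (0::'a) R - {0}"
  have g: "continuous_on (sphere 0 R) (\<lambda>y. w (x + y))"
    by (intro continuous_on_compose2[OF w] continuous_intros) (auto simp: dist_norm)
  have S: "?S \<in> sets borel" "bounded ?S"
    by (auto intro: bounded_subset[OF bounded_ball])
  have "(LINT y:?S|lborel. w (x + (R / norm y) *\<^sub>R y)) \<le> c * measure lborel ?S"
    using S R by (intro set_integral_le_const set_integrable_radial[OF g R] le) (auto simp: dist_norm)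
  then show ?thesis
    using R by (simp add: sphere_mean_eq[OF R w] measure_punctured_ball pos_divide_le_eq)
qed

lemma sphere_mean_diff:
  fixes u v :: "'a::euclidean_space \<Rightarrow> real"
  assumes R: "R > 0" and u: "continuous_on (sphere x R) u" and v: "continuous_on (sphere x R) v"
  shows "sphere_mean (\<lambda>y. u y - v y) x R = sphere_mean u x R - sphere_mean v x R"
proof -
  let ?S = "ball (0::'a) R - {0}"
  have S: "?S \<in> sets borel" "bounded ?S"
    by (auto intro: bounded_subset[OF bounded_ball])
  have i: "set_integrable lborel ?S (\<lambda>y. f (x + (R / norm y) *\<^sub>R y))" if f: "continuous_on (sphere x R) f" for f :: "'a \<Rightarrow> real"
  proof -
    have "continuous_on (sphere 0 R) (\<lambda>y. f (x + y))"
      by (intro continuous_on_compose2[OF f] continuous_intros) (auto simp: dist_norm)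
    from set_integrable_radial[OF this R S] show ?thesis by simp
  qed
  show ?thesis
    unfolding sphere_mean_eq[OF R u] sphere_mean_eq[OF R v]
      sphere_mean_eq[OF R continuous_on_diff[OF u v]] set_integral_diff(2)[OF i[OF u] i[OF v]]
    by (rule diff_divide_distrib)
qed

text \<open>
  At an interior point with a positive maximal value the mean would be \<open>a > 1\<close> times the maximum,
  although no mean exceeds the maximum. A single radius at each point suffices for this.
\<close>

lemma restricted_mean_value_max_principle:
  fixes w :: "'a::euclidean_space \<Rightarrow> real"
  assumes D: "open D" "bounded D" and w: "continuous_on (closure D) w"
    and bd: "\<And>x. x \<in> frontier D \<Longrightarrow> w x \<le> 0"
    and mean: "\<And>x. x \<in> D \<Longrightarrow> \<exists>r>0. \<exists>a>1. ball x r \<subseteq> D \<and> sphere_mean w x r = a * w x"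
    and x: "x \<in> closure D"
  shows "w x \<le> 0"
proof -
  have "compact (closure D)"
    using D(2) by simp
  moreover have "closure D \<noteq> {}"
    by (intro notI) (use x in \<open>simp only: empty_iff\<close>)
  ultimately have "\<exists>z\<in>closure D. \<forall>y\<in>closure D. w y \<le> w z"
    by (rule continuous_attains_sup[OF _ _ w])
  then obtain z where z: "z \<in> closure D" "\<And>y. y \<in> closure D \<Longrightarrow> w y \<le> w z"
    by blast
  have "w z \<le> 0"
  proof (rule ccontr)
    assume pos: "\<not> w z \<le> 0"
    then have "z \<in> D"
      using z(1) bd D(1) by (auto simp: frontier_def interior_open)
    then obtain r a where r: "r > 0" "a > 1" "ball z r \<subseteq> D" "sphere_mean w z r = a * w z"
      using mean by blast
    have "cball z r \<subseteq> closure D"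
      by (rule closed_ball_subset_closure[OF r(3,1)])
    then have s: "sphere z r \<subseteq> closure D"
      by auto
    have "sphere_mean w z r \<le> w z"
      by (rule sphere_mean_le[OF r(1) continuous_on_subset[OF w s]]) (use s z(2) in blast)
    moreover have "1 * w z < a * w z"
      using pos r(2) by (intro mult_strict_right_mono) auto
    ultimately show False
      using r(4) by simp
  qed
  then show ?thesis
    using z(2)[OF x] by simp
qed

lemma eventually_line_in_open:
  fixes x :: "'a::real_normed_vector"
  assumes "open D" "x \<in> D"
  shows "\<forall>\<^sub>F t in nhds 0. x + t *\<^sub>R b \<in> D"
proof -
  have "((\<lambda>t. x + t *\<^sub>R b) \<longlongrightarrow> x + 0 *\<^sub>R b) (nhds 0)"
    by (intro tendsto_intros) (auto simp: filterlim_ident)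
  then show ?thesis
    using assms by (auto dest: topological_tendstoD)
qed

lemma partial_deriv_cong:
  assumes "open D" "\<And>x. x \<in> D \<Longrightarrow> f x = g x" "x \<in> D"
  shows "partial_deriv b f x = partial_deriv b g x"
  unfolding partial_deriv_def
  by (rule deriv_cong_ev[OF eventually_mono[OF eventually_line_in_open[OF assms(1,3)]]]) (use assms in auto)

lemma C1_on_cong:
  assumes D: "open D" and eq: "\<And>x. x \<in> D \<Longrightarrow> f x = g x" and f: "C1_on D f"
  shows "C1_on D g"
  unfolding C1_on_def
proof (intro conjI ballI)
  show "continuous_on D g"
    using f eq by (auto simp: C1_on_def cong: continuous_on_cong)
  fix b :: 'a assume b: "b \<in> Basis"
  show "continuous_on D (partial_deriv b g)"
  proof (subst continuous_on_cong[OF refl])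
    show "partial_deriv b g x = partial_deriv b f x" if "x \<in> D" for x
      by (rule partial_deriv_cong[OF D eq that, symmetric])
    show "continuous_on D (partial_deriv b f)"
      using f b by (simp add: C1_on_def)
  qed
  fix x assume x: "x \<in> D"
  have "\<forall>\<^sub>F t in nhds 0. f (x + t *\<^sub>R b) = g (x + t *\<^sub>R b)"
    by (rule eventually_mono[OF eventually_line_in_open[OF D x]]) (rule eq)
  from DERIV_cong_ev[OF refl this refl] C1_on_has_partial_deriv[OF f b x]
  show "(\<lambda>t. g (x + t *\<^sub>R b)) field_differentiable at 0"
    unfolding field_differentiable_def by blast
qed

lemma panharmonic_on_cong:
  assumes D: "open D" and eq: "\<And>x. x \<in> D \<Longrightarrow> f x = g x" and f: "panharmonic_on \<mu> D f"
  shows "panharmonic_on \<mu> D g"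
proof -
  have p: "partial_deriv b f x = partial_deriv b g x" if "x \<in> D" for b x
    by (rule partial_deriv_cong[OF D eq that])
  have "C1_on D g"
    using C1_on_cong[OF D eq] f by (simp add: panharmonic_on_def C2_on_def)
  moreover have "C1_on D (partial_deriv b g)" if "b \<in> Basis" for b
    using f that by (intro C1_on_cong[OF D p[of _ b]]) (auto simp: panharmonic_on_def C2_on_def)
  moreover have "laplacian f x = laplacian g x" if "x \<in> D" for x
    unfolding laplacian_def by (intro sum.cong refl partial_deriv_cong[OF D p that])
  ultimately show ?thesis
    using f eq by (simp add: panharmonic_on_def C2_on_def)
qed

theorem theorem3p3:
  fixes \<mu> :: real and D :: "'a::euclidean_space set" and u :: "'a \<Rightarrow> real"
  assumes "DIM('a) \<ge> 2"
    and "\<mu> \<noteq> 0"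
    and "open D" and "connected D" and "bounded D"
    and "\<And>f :: 'a \<Rightarrow> real. continuous_on (frontier D) f \<Longrightarrow>
           \<exists>v. panharmonic_on \<mu> D v \<and> continuous_on (closure D) v \<and> (\<forall>x\<in>frontier D. v x = f x)"
    and "continuous_on (closure D) u"
    and "\<And>x. x \<in> D \<Longrightarrow>
           \<exists>r>0. ball x r \<subseteq> D \<and> sphere_mean u x r = a_circ DIM('a) (\<mu> * r) * u x"
  shows "panharmonic_on \<mu> D u"
proof -
  note D = assms(3,5) and u = assms(7)
  have "continuous_on (frontier D) u"
    by (rule continuous_on_subset[OF u]) (auto simp: frontier_def)
  then obtain v where v: "panharmonic_on \<mu> D v" "continuous_on (closure D) v"
    "\<And>x. x \<in> frontier D \<Longrightarrow> v x = u x"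
    using assms(6) by blast
  have mean: "\<exists>r>0. \<exists>a>1. ball x r \<subseteq> D \<and> sphere_mean u x r = a * u x \<and> sphere_mean v x r = a * v x \<and>
      continuous_on (sphere x r) u \<and> continuous_on (sphere x r) v" if x: "x \<in> D" for x
  proof -
    obtain r where r: "r > 0" "ball x r \<subseteq> D" "sphere_mean u x r = a_circ DIM('a) (\<mu> * r) * u x"
      using assms(8)[OF x] by blast
    have "sphere x r \<subseteq> closure D"
      using closed_ball_subset_closure[OF r(2,1)] by auto
    moreover have "a_circ DIM('a) (\<mu> * r) > 1"
      using assms(1,2) r(1) by (intro a_circ_gt_1) auto
    ultimately show ?thesis
      using r panharmonic_sphere_mean[OF assms(1) v(1,2) r(1,2)] u v(2)
      by (intro exI[of _ r] exI[of _ "a_circ DIM('a) (\<mu> * r)"] conjI) (auto intro: continuous_on_subset)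
  qed
  have mean': "\<exists>r>0. \<exists>a>1. ball x r \<subseteq> D \<and> sphere_mean v x r = a * v x \<and> sphere_mean u x r = a * u x \<and>
      continuous_on (sphere x r) v \<and> continuous_on (sphere x r) u" if "x \<in> D" for x
    using mean[OF that] by blast
  \<comment> \<open>Stated for a pair of functions so as to be applied to \<open>u, v\<close> and to \<open>v, u\<close>.\<close>
  have le: "f x - g x \<le> 0"
    if fg: "continuous_on (closure D) f" "continuous_on (closure D) g" "\<And>y. y \<in> frontier D \<Longrightarrow> f y = g y"
      and mean: "\<And>y. y \<in> D \<Longrightarrow> \<exists>r>0. \<exists>a>1. ball y r \<subseteq> D \<and> sphere_mean f y r = a * f y \<and>
        sphere_mean g y r = a * g y \<and> continuous_on (sphere y r) f \<and> continuous_on (sphere y r) g"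
      and x: "x \<in> D" for f g :: "'a \<Rightarrow> real" and x
  proof (rule restricted_mean_value_max_principle[OF D])
    show "continuous_on (closure D) (\<lambda>y. f y - g y)"
      by (intro continuous_on_diff fg)
    show "f y - g y \<le> 0" if "y \<in> frontier D" for y
      using fg(3)[OF that] by simp
    show "x \<in> closure D"
      using x closure_subset by blast
    fix y assume "y \<in> D"
    from mean[OF this] obtain r a where r: "r > 0" "a > 1" "ball y r \<subseteq> D" "sphere_mean f y r = a * f y"
        "sphere_mean g y r = a * g y" "continuous_on (sphere y r) f" "continuous_on (sphere y r) g"
      by blast
    then have "sphere_mean (\<lambda>y. f y - g y) y r = a * (f y - g y)"
      by (simp add: sphere_mean_diff right_diff_distrib)
    with r show "\<exists>r>0. \<exists>a>1. ball y r \<subseteq> D \<and> sphere_mean (\<lambda>y. f y - g y) y r = a * (f y - g y)"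
      by blast
  qed
  have "v x = u x" if x: "x \<in> D" for x
  proof -
    have "u x - v x \<le> 0"
      by (rule le[OF u v(2) v(3)[symmetric] mean x])
    moreover have "v x - u x \<le> 0"
      by (rule le[OF v(2) u v(3) mean' x])
    ultimately show ?thesis by simp
  qed
  then show ?thesis
    by (rule panharmonic_on_cong[OF assms(3) _ v(1)])
qed

end
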